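(* For any tower group $G_0$, the LatAut tower $G_0, G_1, G_2, \dots$ of $G_0$ satisfies $G_3 = 1$ (the trivial group). This bound is sharp: for $G_0 = S_4^2 \times S_3^2$ one has $G_3 = 1$ and $G_2 \neq 1$.
   Context: All groups are finite. $S_n$ denotes the symmetric group on $n$ letters. A tower group is a finite group isomorphic to $\prod_{k \geq 3} S_k^{a_k}$, where the $a_k \geq 0$ are integers and only finitely many of them are nonzero. For a finite group $G$, $\mathcal{N}(G)$ is the lattice of normal subgroups of $G$ ordered by inclusion. $\operatorname{LatAut}(G) = \operatorname{Aut}(\mathcal{N}(G))$ is the group, under composition, of all bijections $\varphi : \mathcal{N}(G) \to \mathcal{N}(G)$ such that $H \leq K \Leftrightarrow \varphi(H) \leq \varphi(K)$ for all $H, K \in \mathcal{N}(G)$. The LatAut tower of a finite group $G$ is the sequence of finite groups defined by $G_0 = G$ and $G_{n+1} = \operatorname{LatAut}(G_n) = \operatorname{Aut}(\mathcal{N}(G_n))$ for $n \geq 0$. *)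

theory Defs
  imports "HOL-Algebra.Algebra"
begin

definition group_power :: "('a, 'b) monoid_scheme \<Rightarrow> nat \<Rightarrow> (nat \<Rightarrow> 'a) monoid" where
  "group_power G n = product_group {..<n} (\<lambda>_. G)"

text \<open>The product runs over all \<open>k \<ge> 3\<close>; factors with \<open>a k = 0\<close> are one-element groups, and the
  values \<open>a k\<close> for \<open>k < 3\<close> are not used.\<close>

definition tower_group :: "('a, 'b) monoid_scheme \<Rightarrow> bool" where
  "tower_group G \<longleftrightarrow> group G \<and> finite (carrier G) \<and>
     (\<exists>a :: nat \<Rightarrow> nat. finite {k. k \<ge> 3 \<and> a k \<noteq> 0} \<and>
        G \<cong> product_group {3..} (\<lambda>k. group_power (sym_group k) (a k)))"

definition normal_subgroup_lattice :: "('a, 'b) monoid_scheme \<Rightarrow> 'a set gorder" where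
  "normal_subgroup_lattice G = \<lparr>carrier = {N. N \<lhd> G}, eq = (=), le = (\<subseteq>)\<rparr>"

text \<open>As in \<^const>\<open>AutoGroup\<close>, the elements are functions restricted to the carrier
  (with the value \<^const>\<open>undefined\<close> outside it), so that distinct elements are distinct maps on the
  carrier.\<close>

definition order_AutoGroup :: "('a, 'b) gorder_scheme \<Rightarrow> ('a \<Rightarrow> 'a) monoid" where
  "order_AutoGroup L = BijGroup (carrier L)
     \<lparr>carrier := {\<phi> \<in> Bij (carrier L).
        \<forall>x \<in> carrier L. \<forall>y \<in> carrier L. x \<sqsubseteq>\<^bsub>L\<^esub> y \<longleftrightarrow> \<phi> x \<sqsubseteq>\<^bsub>L\<^esub> \<phi> y}\<rparr>"

text \<open>The type of \<open>LatAut G\<close> differs from that of \<open>G\<close>, so the tower \<open>G\<^sub>0, G\<^sub>1, \<dots>\<close> is not a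
  function on \<^typ>\<open>nat\<close>; its terms are \<open>G\<close>, \<open>LatAut G\<close>, \<open>LatAut (LatAut G)\<close>, and so on.\<close>

definition LatAut :: "('a, 'b) monoid_scheme \<Rightarrow> ('a set \<Rightarrow> 'a set) monoid" where
  "LatAut G = order_AutoGroup (normal_subgroup_lattice G)"

lemma subgroup_order_AutoGroup:
  "subgroup (carrier (order_AutoGroup L)) (BijGroup (carrier L))"
proof -
  interpret B: group "BijGroup (carrier L)" by (rule group_BijGroup)
  show ?thesis
  proof (rule B.subgroupI)
    show "carrier (order_AutoGroup L) \<subseteq> carrier (BijGroup (carrier L))"
      by (auto simp: order_AutoGroup_def BijGroup_def)
    show "carrier (order_AutoGroup L) \<noteq> {}"
      using id_Bij[of "carrier L"]
      by (auto simp: order_AutoGroup_def intro!: exI[of _ "\<lambda>x\<in>carrier L. x"])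
  next
    fix f assume f: "f \<in> carrier (order_AutoGroup L)"
    then have fB: "f \<in> Bij (carrier L)" by (simp add: order_AutoGroup_def)
    then have b: "bij_betw f (carrier L) (carrier L)" by (simp add: Bij_def)
    have "inv_into (carrier L) f x \<in> carrier L" "f (inv_into (carrier L) f x) = x"
      if "x \<in> carrier L" for x
      using that b by (auto simp: bij_betw_def f_inv_into_f inv_into_into)
    then show "inv\<^bsub>BijGroup (carrier L)\<^esub> f \<in> carrier (order_AutoGroup L)"
      using f fB by (auto simp: order_AutoGroup_def inv_BijGroup restrict_inv_into_Bij)
  next
    fix f g assume fg: "f \<in> carrier (order_AutoGroup L)" "g \<in> carrier (order_AutoGroup L)"
    then have B: "f \<in> Bij (carrier L)" "g \<in> Bij (carrier L)"
      by (simp_all add: order_AutoGroup_def)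
    have "g x \<in> carrier L" if "x \<in> carrier L" for x
      using Bij_imp_funcset[OF B(2)] that by (rule funcset_mem)
    then show "f \<otimes>\<^bsub>BijGroup (carrier L)\<^esub> g \<in> carrier (order_AutoGroup L)"
      using fg B by (simp add: order_AutoGroup_def BijGroup_def compose_Bij compose_eq)
  qed
qed

lemma group_LatAut: "group (LatAut G)"
proof -
  let ?L = "normal_subgroup_lattice G"
  have "group (BijGroup (carrier ?L) \<lparr>carrier := carrier (order_AutoGroup ?L)\<rparr>)"
    by (rule subgroup.subgroup_is_group[OF subgroup_order_AutoGroup group_BijGroup])
  then show ?thesis by (simp add: LatAut_def order_AutoGroup_def)
qed

end

(*
  The commutator of an element f of a normal subgroup N of a product of symmetric groups with
  elements of one factor lies in N and in that factor.  Hence for each factor of degree at least 3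
  the subgroup N either projects trivially, or contains its alternating group, or (in degree 4) it
  projects onto the Klein four-group and contains it.  What remains of N is the space of its sign
  vectors, a linear code over the field with two elements.

  If all degrees are at least 3, an automorphism of the lattice permutes the atoms, that is, the
  factors, and is determined by this permutation.  The factors of degree 4 are the ones with a
  longer chain above the atom, so they are permuted among themselves, and the automorphism group
  is S_p x S_q, where p and q are the numbers of factors of degree 4 and of other degrees.

  The lattice of S_p x S_q has at most two automorphisms, except when p = q = 2: there it is the
  diamond with three atoms, whose automorphism group is S_3.  In both cases the normal subgroups of
  the automorphism group form a chain, and a finite chain has no nontrivial automorphism.
*)

theory Submission
  imports Defs
begin

section \<open>Normal subgroups of symmetric groups\<close>

text \<open>The classification of normal subgroups is applied to two groups: the given one, with all
  degrees at least 3, and its automorphism group S_p x S_q, where degrees 0, 1 and 2 also occur.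
  Hence the encoding keeps a separate set for factors of degree 2.

  The obstacle is that a space over the field with two elements has many lattice automorphisms,
  coming from all invertible linear maps. Degrees of at least 3 remove this freedom: a sign vector
  with support \<open>w\<close> requires the alternating subgroups of all factors in
  \<open>w\<close>, so the order remembers its coordinates. In degree 2 the alternating subgroup is
  trivial and leaves no such trace. For p = q = 2 only the subspace lattice of a plane over that
  field remains, and its S_3 is the general linear group of this plane.

  Apart from the index set, the encoded lattice sees only the class of a degree: at most 1, equal to
  2, equal to 4, or any other. So two factors give finitely many lattices, and those with exactly
  one factor of degree 2 are settled by evaluation.\<close>

lemma sym_normal_sub: "M \<lhd> sym_group n \<Longrightarrow> h \<in> M \<Longrightarrow> h permutes {1..n}"
  by (metis normal_imp_subgroup subgroup.mem_carrier sym_group_carrier)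

lemma sym_normal_comp: "M \<lhd> sym_group n \<Longrightarrow> f \<in> M \<Longrightarrow> g \<in> M \<Longrightarrow> f \<circ> g \<in> M"
  by (metis normal_imp_subgroup subgroup.m_closed sym_group_mult)

lemma sym_normal_conj:
  assumes "M \<lhd> sym_group n" "h \<in> M" "p permutes {1..n}"
  shows "p \<circ> h \<circ> inv' p \<in> M"
  using normal.inv_op_closed2[OF assms(1), of p h] assms
  by (simp add: sym_group_carrier sym_group_mult)

section \<open>Conjugation and three-cycles\<close>

lemma conj_transpose:
  assumes "bij f"
  shows "f \<circ> transpose a b \<circ> inv' f = transpose (f a) (f b)"
proof
  fix x
  have "f (transpose a b (inv' f x)) = transpose (f a) (f b) (f (inv' f x))"
    using assms by (auto simp: transpose_def dest: bij_is_inj injD)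
  then show "(f \<circ> transpose a b \<circ> inv' f) x = transpose (f a) (f b) x"
    using assms by (simp add: bij_is_surj surj_f_inv_f)
qed

text \<open>Three transpositions correct the values one at a time, and each leaves the values
  already reached fixed.\<close>

lemma exists_permutes_triple:
  assumes "distinct [a, b, c]" "distinct [x, y, z]" "{a, b, c, x, y, z} \<subseteq> S"
  obtains p where "p permutes S" "p a = x" "p b = y" "p c = z"
proof -
  define p1 where "p1 = transpose a x"
  define p2 where "p2 = transpose (p1 b) y"
  define p3 where "p3 = transpose (p2 (p1 c)) z"
  have p1: "p1 permutes S" using assms by (auto simp: p1_def intro: permutes_swap_id)
  have b: "p1 b \<in> S" "p1 c \<in> S" using assms permutes_in_image[OF p1] by auto
  have p2: "p2 permutes S" using assms b by (auto simp: p2_def intro: permutes_swap_id)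
  have c: "p2 (p1 c) \<in> S" using b permutes_in_image[OF p2] by auto
  have p3: "p3 permutes S" using assms c by (auto simp: p3_def intro: permutes_swap_id)
  have inj: "inj p1" "inj p2" using p1 p2 by (auto intro: permutes_inj)
  have 1: "p1 a = x" by (simp add: p1_def)
  have "p1 b \<noteq> x" "p1 c \<noteq> x" "p1 b \<noteq> p1 c" using 1 inj assms by (auto dest: injD)
  then have 2: "p2 x = x" "p2 (p1 b) = y" using assms by (auto simp: p2_def transpose_def)
  then have "p2 (p1 c) \<noteq> x" "p2 (p1 c) \<noteq> y"
    using inj \<open>p1 c \<noteq> x\<close> \<open>p1 b \<noteq> p1 c\<close> by (metis injD)+
  then have 3: "p3 x = x" "p3 y = y" "p3 (p2 (p1 c)) = z"
    using assms by (auto simp: p3_def transpose_def)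
  show thesis
    using p1 p2 p3 1 2 3 by (intro that[of "p3 \<circ> (p2 \<circ> p1)"] permutes_compose) auto
qed

text \<open>All three-cycles are conjugate in the symmetric group and they generate the alternating
  group, so a single one suffices. The product of transpositions is
  \<open>cycle_of_list [a, b, c]\<close> without its trailing identity.\<close>

lemma alt_group_subset_of_three_cycle:
  assumes M: "M \<lhd> sym_group n" and abc: "distinct [a, b, c]" "{a, b, c} \<subseteq> {1..n}"
    and in_M: "transpose a b \<circ> transpose b c \<in> M"
  shows "carrier (alt_group n) \<subseteq> M"
proof -
  have "three_cycles n \<subseteq> M"
  proof
    fix q assume "q \<in> three_cycles n"
    then obtain cs where cs: "q = cycle_of_list cs" "cycle cs" "length cs = 3" "set cs \<subseteq> {1..n}"
      by auto
    obtain x y z where xyz: "cs = [x, y, z]"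
      using stupid_lemma[OF cs(3)] by auto
    obtain p where p: "p permutes {1..n}" "p a = x" "p b = y" "p c = z"
      using exists_permutes_triple[of a b c x y z "{1..n}"] abc cs xyz by auto
    have "p \<circ> cycle_of_list [a, b, c] \<circ> inv' p = q"
      using conjugation_of_cycle[of "[a,b,c]" p] abc p cs xyz permutes_bij[OF p(1)] by simp
    then show "q \<in> M"
      using sym_normal_conj[OF M _ p(1)] in_M by (metis comp_id cycle_of_list.simps(1,3))
  qed
  moreover have "generate (sym_group n) (three_cycles n) \<subseteq> M" if "three_cycles n \<subseteq> M"
    using group.generate_subgroup_incl[OF sym_group_is_group that] M normal_imp_subgroup by blast
  \<comment> \<open>Generation by three-cycles is known inside \<open>alt_group n\<close>, while
    \<open>M\<close> is a subgroup of the whole symmetric group; both groups generate the same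
    set.\<close>
  moreover have "generate (alt_group n) (three_cycles n) = generate (sym_group n) (three_cycles n)"
    using group.generate_consistent[OF sym_group_is_group three_cycles_incl alt_group_is_subgroup]
    by (simp add: alt_group_def)
  ultimately show ?thesis
    by (simp add: alt_group_carrier_as_three_cycles)
qed

section \<open>The Klein four-group in degree 4\<close>

text \<open>Describing the elements as the identity and the fixed-point-free involutions makes
  invariance under conjugation visible.\<close>

definition klein4 :: "(nat \<Rightarrow> nat) set" where
  "klein4 = {h. h permutes {1..4} \<and> (h = id \<or> (\<forall>x\<in>{1..4}. h x \<noteq> x \<and> h (h x) = x))}"

lemma upto_4: "{1..4} = {1, 2, 3, 4::nat}"
  by auto

lemma permutes_4_eqI:
  assumes "f permutes {1..4::nat}" "g permutes {1..4}"
    "f 1 = g 1" "f 2 = g 2" "f 3 = g 3" "f 4 = g 4"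
  shows "f = g"
proof
  fix x show "f x = g x"
  proof (cases "x \<in> {1..4}")
    case True
    then have "x = 1 \<or> x = 2 \<or> x = 3 \<or> x = 4" by auto
    then show ?thesis using assms(3-6) by (elim disjE) simp_all
  qed (use assms(1,2) in \<open>simp add: permutes_not_in\<close>)
qed

text \<open>For a fixed-point-free involution on four points the image of 1 decides the rest, which
  leaves three value tables besides the identity. In this form closure under composition is a finite
  check.\<close>

lemma klein4_iff:
  "h \<in> klein4 \<longleftrightarrow> h permutes {1..4} \<and>
     (h 1 = 1 \<and> h 2 = 2 \<and> h 3 = 3 \<and> h 4 = 4 \<or> h 1 = 2 \<and> h 2 = 1 \<and> h 3 = 4 \<and> h 4 = 3 \<or>
      h 1 = 3 \<and> h 2 = 4 \<and> h 3 = 1 \<and> h 4 = 2 \<or> h 1 = 4 \<and> h 2 = 3 \<and> h 3 = 2 \<and> h 4 = 1)"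
  (is "?l \<longleftrightarrow> ?p \<and> (?a \<or> ?b \<or> ?c \<or> ?d)")
proof
  assume l: ?l
  then have p: ?p by (simp only: klein4_def mem_Collect_eq)
  show "?p \<and> (?a \<or> ?b \<or> ?c \<or> ?d)"
  proof (cases "h = id")
    case True
    then show ?thesis using p by simp
  next
    case False
    then have inv: "h x \<noteq> x" "h (h x) = x" if "x \<in> {1, 2, 3, 4}" for x
      using l that unfolding klein4_def upto_4 by blast+
    have h1: "h 1 \<in> {1, 2, 3, 4}" and h2: "h 2 \<in> {1, 2, 3, 4}" and h3: "h 3 \<in> {1, 2, 3, 4}"
      using permutes_in_image[OF p] unfolding upto_4 by blast+
    have one: "h 1 \<noteq> 1" "h 2 \<noteq> 2" "h 3 \<noteq> 3" "h (h 1) = 1" "h (h 2) = 2" "h (h 3) = 3" 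
      using inv by blast+
    consider "h 1 = 2" | "h 1 = 3" | "h 1 = 4" using h1 one(1) by blast
    then show ?thesis
    proof cases
      case 1
      then have "h 2 = 1" "h 3 = 4" using one h3 by fastforce+
      then show ?thesis using p 1 one(6) by simp
    next
      case 2
      then have "h 3 = 1" "h 2 = 4" using one h2 by fastforce+
      then show ?thesis using p 2 one(5) by simp
    next
      case 3
      then have "h 4 = 1" "h 2 = 3" using one h2 by fastforce+
      then show ?thesis using p 3 one(5) by simp
    qed
  qed
next
  assume r: "?p \<and> (?a \<or> ?b \<or> ?c \<or> ?d)"
  then consider ?a | "?b \<or> ?c \<or> ?d" by blast
  then have "h = id \<or> (\<forall>x\<in>{1, 2, 3, 4}. h x \<noteq> x \<and> h (h x) = x)"
  proof cases
    case 1
    then have "h = id" using r by (intro permutes_4_eqI permutes_id) simp_all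
    then show ?thesis ..
  next
    case 2
    then show ?thesis by (elim disjE conjE) simp_all
  qed
  then show ?l using r unfolding klein4_def upto_4 by simp
qed

lemma klein4_permutes: "h \<in> klein4 \<Longrightarrow> h permutes {1..4}"
  by (simp add: klein4_def)

lemma klein4_comp: 
  assumes "f \<in> klein4" "g \<in> klein4" shows "f \<circ> g \<in> klein4"
  using assms permutes_compose[of g "{1..4}" f] unfolding klein4_iff by (elim conjE disjE) simp_all

lemma klein4_involution: "f \<in> klein4 \<Longrightarrow> f \<circ> f = id"
  by (rule permutes_4_eqI[OF permutes_compose permutes_id]) (unfold klein4_iff, auto)

lemma klein4_inv: "f \<in> klein4 \<Longrightarrow> inv' f \<in> klein4"
  using inv_unique_comp klein4_involution by metis

lemma id_in_klein4: "id \<in> klein4"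
  by (simp add: klein4_def permutes_id)

lemma klein4_conj:
  assumes "h \<in> klein4" "p permutes {1..4}" shows "p \<circ> h \<circ> inv' p \<in> klein4"
proof (cases "h = id")
  case True
  then show ?thesis using assms permutes_inv_o id_in_klein4 by fastforce
next
  case False
  then have h: "h permutes {1..4}" "\<And>x. x \<in> {1..4} \<Longrightarrow> h x \<noteq> x \<and> h (h x) = x"
    using assms by (auto simp: klein4_def)
  have "p (h (inv' p x)) \<noteq> x \<and> p (h (inv' p (p (h (inv' p x))))) = x" if "x \<in> {1..4}" for x
    using h(2)[of "inv' p x"] that assms(2)
    by (metis permutes_inv permutes_in_image permutes_inverses)
  then show ?thesis
    unfolding klein4_def
    using permutes_compose[OF permutes_inv[OF assms(2)] permutes_compose[OF h(1) assms(2)]] by auto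
qed

text \<open>The Klein four-group acts regularly on four points.\<close>

lemma klein4_eqI: "f \<in> klein4 \<Longrightarrow> g \<in> klein4 \<Longrightarrow> f 1 = g 1 \<Longrightarrow> f = g"
  by (rule permutes_4_eqI) (auto simp: klein4_iff)

text \<open>Conjugation by the transposition of \<open>g 1\<close> and \<open>h 1\<close>, which
  fixes 1, turns \<open>g\<close> into a Klein element sending 1 to \<open>h 1\<close>; by
  regularity this is \<open>h\<close>.\<close>

lemma klein4_subset_of_mem:
  assumes M: "M \<lhd> sym_group 4" and g: "g \<in> M" "g \<in> klein4" "g \<noteq> id"
  shows "klein4 \<subseteq> M"
proof
  fix h assume h: "h \<in> klein4"
  have g1: "g 1 \<noteq> 1" "g 1 \<in> {1..4}"
    using g klein4_eqI[OF g(2) id_in_klein4] klein4_permutes[OF g(2)] by (auto simp: klein4_iff)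
  show "h \<in> M"
  proof (cases "h = id")
    case True
    then show ?thesis
      using sym_normal_comp[OF M g(1) g(1)] klein4_involution[OF g(2)] by simp
  next
    case False
    then have h1: "h 1 \<noteq> 1" "h 1 \<in> {1..4}"
      using klein4_eqI[OF h id_in_klein4] klein4_permutes[OF h] h by (auto simp: klein4_iff)
    define p where "p = transpose (g 1) (h 1)"
    have p: "p permutes {1..4}" using g1 h1 by (auto simp: p_def intro: permutes_swap_id)
    have "inv' p = p" by (simp add: p_def)
    then have "(p \<circ> g \<circ> inv' p) 1 = h 1" using g1 h1 by (simp add: p_def transpose_def)
    then have "p \<circ> g \<circ> inv' p = h" using klein4_eqI[OF klein4_conj[OF g(2) p] h] by simp
    then show ?thesis using sym_normal_conj[OF M g(1) p] by simp
  qed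
qed

lemma klein4_subset_alt_group: "klein4 \<subseteq> carrier (alt_group 4)"
proof
  fix h assume h: "h \<in> klein4"
  show "h \<in> carrier (alt_group 4)"
  proof (cases "h = id")
    case False
    have hp: "h permutes {1..4}" using h by (rule klein4_permutes)
    have "h 1 \<noteq> 1" using False klein4_eqI[OF h id_in_klein4] by auto
    then consider "h 1 = 2" "h 2 = 1" "h 3 = 4" "h 4 = 3" | "h 1 = 3" "h 2 = 4" "h 3 = 1" "h 4 = 2"
      | "h 1 = 4" "h 2 = 3" "h 3 = 2" "h 4 = 1"
      using h unfolding klein4_iff by auto
    then obtain a b c d where abcd: "a \<noteq> b" "c \<noteq> d" "{a, b, c, d} \<subseteq> {1..4::nat}"
      and eq: "h = transpose a b \<circ> transpose c d"
    proof cases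
      case 1
      then have "h = transpose 1 2 \<circ> transpose 3 4"
        by (intro permutes_4_eqI[OF hp] permutes_compose permutes_swap_id) auto
      then show thesis by (intro that[of 1 2 3 4]) auto
    next
      case 2
      then have "h = transpose 1 3 \<circ> transpose 2 4"
        by (intro permutes_4_eqI[OF hp] permutes_compose permutes_swap_id) auto
      then show thesis by (intro that[of 1 3 2 4]) auto
    next
      case 3
      then have "h = transpose 1 4 \<circ> transpose 2 3"
        by (intro permutes_4_eqI[OF hp] permutes_compose permutes_swap_id) auto
      then show thesis by (intro that[of 1 4 2 3]) auto
    qed
    have "evenperm h"
      unfolding eq using abcd by (subst evenperm_comp) (auto simp: permutation_swap_id evenperm_swap)
    then show ?thesis using hp by (simp add: alt_group_carrier)
  qed (simp add: alt_group_carrier permutes_id)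
qed

section \<open>Commutators with transpositions\<close>

text \<open>The commutator is the conjugated transposition times the original one. The hypothesis
  speaks of commutators instead of \<open>h\<close> itself because \<open>h\<close> will be a
  component of an element of a normal subgroup of a product, where \<open>h\<close> alone need not
  belong to the part inside that factor.\<close>

lemma commutator_transpose_mem:
  assumes h: "h permutes {1..n}" and comm: "\<And>t. t permutes {1..n} \<Longrightarrow> h \<circ> t \<circ> inv' h \<circ> inv' t \<in> M"
    and "a \<in> {1..n}" "d \<in> {1..n}"
  shows "transpose (h a) (h d) \<circ> transpose a d \<in> M"
  using comm[OF permutes_swap_id[OF assms(3,4)]] by (simp add: conj_transpose[OF permutes_bij[OF h]])

text \<open>With \<open>d\<close> fixed and \<open>a\<close> moved, the two transpositions in the
  commutator share exactly the point \<open>d\<close>, so their product is a three-cycle.\<close>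

lemma alt_group_subset_of_fixed_point:
  assumes M: "M \<lhd> sym_group n" and h: "h permutes {1..n}"
    and comm: "\<And>t. t permutes {1..n} \<Longrightarrow> h \<circ> t \<circ> inv' h \<circ> inv' t \<in> M"
    and ad: "a \<in> {1..n}" "d \<in> {1..n}" "h a \<noteq> a" "h d = d"
  shows "carrier (alt_group n) \<subseteq> M"
proof -
  have "h a \<noteq> d" "a \<noteq> d" using ad permutes_inj[OF h] by (auto dest: injD)
  then show ?thesis
    using commutator_transpose_mem[OF h comm ad(1,2)] ad permutes_in_image[OF h]
    by (intro alt_group_subset_of_three_cycle[OF M, of "h a" d a]) (auto simp: transpose_commute)
qed

text \<open>A commutator of \<open>h\<close> with a transposition is a 3-cycle unless \<open>h\<close> is a fixed-point-free
  involution. In that case it is a double transposition, which again has a fixed point and moves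
  another one once \<open>n \<ge> 5\<close>.\<close>

lemma sym_normal_cases:
  assumes M: "M \<lhd> sym_group n" and n: "n \<ge> 3" and h: "h permutes {1..n}"
    and comm: "\<And>t. t permutes {1..n} \<Longrightarrow> h \<circ> t \<circ> inv' h \<circ> inv' t \<in> M"
  shows "h = id \<or> carrier (alt_group n) \<subseteq> M \<or> n = 4 \<and> h \<in> klein4 \<and> klein4 \<subseteq> M"
proof (cases "(\<exists>x. h x \<noteq> x \<and> h (h x) \<noteq> x) \<or> (\<exists>d\<in>{1..n}. h d = d)")
  case True
  then consider x where "h x \<noteq> x" "h (h x) \<noteq> x" | d where "d \<in> {1..n}" "h d = d" by auto
  then show ?thesis
  proof cases
    case 1
    then have "x \<in> {1..n}" "h x \<in> {1..n}" "h (h x) \<in> {1..n}" "h (h x) \<noteq> h x"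
      using h permutes_inj[OF h] permutes_in_image[OF h] by (auto simp: permutes_def dest: injD)
    \<comment> \<open>The points \<open>x\<close>, \<open>h x\<close> and \<open>h (h x)\<close> are
      distinct, so the commutator with the transposition of the first two is a three-cycle.\<close>
    then have "carrier (alt_group n) \<subseteq> M"
      using commutator_transpose_mem[OF h comm, of "h x" x] 1
      by (intro alt_group_subset_of_three_cycle[OF M, of "h (h x)" "h x" x]) auto
    then show ?thesis by simp
  next
    case 2
    show ?thesis
    proof (cases "h = id")
      case False
      then obtain a where "h a \<noteq> a" by (auto simp: fun_eq_iff)
      then show ?thesis
        using alt_group_subset_of_fixed_point[OF M h comm, of a d] 2 h by (auto simp: permutes_def)
    qed simp
  qed
next
  case False
  then have inv: "\<And>x. x \<in> {1..n} \<Longrightarrow> h x \<noteq> x" "\<And>x. h (h x) = x"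
    by metis+
  \<comment> \<open>\<open>d\<close> is a point other than 1 and \<open>h 1\<close>, for which
    degree 3 leaves room. Then 1, \<open>d\<close> and their images are four distinct points, and
    \<open>g\<close> swaps 1 with \<open>d\<close> and \<open>h 1\<close> with
    \<open>h d\<close>.\<close>
  define d where "d = (if h 1 = 2 then 3 else 2 :: nat)"
  have d: "d \<in> {1..n}" "d \<noteq> 1" "d \<noteq> h 1" using n by (auto simp: d_def)
  have one: "(1::nat) \<in> {1..n}" using n by simp
  define g where "g = transpose (h 1) (h d) \<circ> transpose 1 d"
  have gM: "g \<in> M" using commutator_transpose_mem[OF h comm, of 1 d] d n by (auto simp: g_def)
  have ne: "h 1 \<noteq> 1" "h d \<noteq> d" "h d \<noteq> 1" "h d \<noteq> h 1" "h 1 \<in> {1..n}" "h d \<in> {1..n}"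
    using d one inv permutes_in_image[OF h] by (auto, metis+)
  have vals: "g 1 = d" "g d = 1" "g (h 1) = h d" "g (h d) = h 1"
    using ne d by (auto simp: g_def transpose_def)
  have c4: "card {1, d, h 1, h d} = 4" using ne d by auto
  have sub: "{1, d, h 1, h d} \<subseteq> {1..n}" using ne d one by auto
  have gp: "g permutes {1..n}" using sym_normal_sub[OF M gM] .
  show ?thesis
  proof (cases "n = 4")
    case True
    have "{1, d, h 1, h d} = {1..4}"
      using sub c4 True by (intro card_subset_eq) auto
    then have "\<forall>x\<in>{1..4}. g x \<noteq> x \<and> g (g x) = x"
      using vals ne d by (metis empty_iff insert_iff)
    then have "g \<in> klein4" "g \<noteq> id"
      using gp True vals(1) d(2) unfolding klein4_def by auto
    moreover have "h \<in> klein4" using h inv True by (simp add: klein4_def)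
    ultimately show ?thesis using klein4_subset_of_mem M gM True by auto
  next
    case False
    have "n > 4" using card_mono[OF _ sub] c4 False by simp
    then have "card ({1..n} - {1, d, h 1, h d}) > 0"
      using sub c4 by (subst card_Diff_subset) auto
    then have "{1..n} - {1, d, h 1, h d} \<noteq> {}" by (metis card.empty less_numeral_extra(3))
    then obtain e where e: "e \<in> {1..n}" "e \<notin> {1, d, h 1, h d}" by blast
    have "g e = e" using e by (auto simp: g_def transpose_def)
    \<comment> \<open>Since \<open>g\<close> itself lies in \<open>M\<close>, normality supplies its
      commutators.\<close>
    moreover have "g \<circ> t \<circ> inv' g \<circ> inv' t \<in> M" if t: "t permutes {1..n}" for t
    proof -
      have "t \<circ> inv' g \<circ> inv' t \<in> M"
        using sym_normal_conj[OF M _ t] gM M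
        by (metis normal_imp_subgroup subgroup.m_inv_closed subgroup.mem_carrier sym_group_inv_equality)
      then show ?thesis using sym_normal_comp[OF M gM] by (simp add: comp_assoc)
    qed
    ultimately show ?thesis
      using alt_group_subset_of_fixed_point[OF M gp, of 1 e] e one vals d by auto
  qed
qed

section \<open>Isomorphisms of orders, groups and products\<close>

definition order_isomorphism :: "('a, 'c) gorder_scheme \<Rightarrow> ('b, 'd) gorder_scheme \<Rightarrow> ('a \<Rightarrow> 'b) \<Rightarrow> bool" where
  "order_isomorphism L M h \<longleftrightarrow> bij_betw h (carrier L) (carrier M) \<and>
     (\<forall>x\<in>carrier L. \<forall>y\<in>carrier L. x \<sqsubseteq>\<^bsub>L\<^esub> y \<longleftrightarrow> h x \<sqsubseteq>\<^bsub>M\<^esub> h y)"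

lemma order_isomorphismI:
  assumes "bij_betw h (carrier L) (carrier M)"
    "\<And>x y. x \<in> carrier L \<Longrightarrow> y \<in> carrier L \<Longrightarrow> x \<sqsubseteq>\<^bsub>L\<^esub> y \<longleftrightarrow> h x \<sqsubseteq>\<^bsub>M\<^esub> h y"
  shows "order_isomorphism L M h"
  using assms by (simp add: order_isomorphism_def)

lemma order_isomorphism_bij: "order_isomorphism L M h \<Longrightarrow> bij_betw h (carrier L) (carrier M)"
  by (simp add: order_isomorphism_def)

lemma order_isomorphism_mem: "order_isomorphism L M h \<Longrightarrow> x \<in> carrier L \<Longrightarrow> h x \<in> carrier M"
  by (meson order_isomorphism_bij bij_betwE)

lemma order_isomorphism_le:
  "order_isomorphism L M h \<Longrightarrow> x \<in> carrier L \<Longrightarrow> y \<in> carrier L \<Longrightarrow> h x \<sqsubseteq>\<^bsub>M\<^esub> h y \<longleftrightarrow> x \<sqsubseteq>\<^bsub>L\<^esub> y"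
  by (simp add: order_isomorphism_def)

lemma order_isomorphism_inv:
  assumes "order_isomorphism L M h"
  shows "order_isomorphism M L (inv_into (carrier L) h)"
proof (rule order_isomorphismI)
  note b = order_isomorphism_bij[OF assms]
  show "bij_betw (inv_into (carrier L) h) (carrier M) (carrier L)"
    by (rule bij_betw_inv_into[OF b])
  fix x y assume xy: "x \<in> carrier M" "y \<in> carrier M"
  have "inv_into (carrier L) h z \<in> carrier L" "h (inv_into (carrier L) h z) = z" if "z \<in> carrier M" for z
    using b that by (auto simp: bij_betw_def inv_into_into f_inv_into_f)
  then show "x \<sqsubseteq>\<^bsub>M\<^esub> y \<longleftrightarrow> inv_into (carrier L) h x \<sqsubseteq>\<^bsub>L\<^esub> inv_into (carrier L) h y"
    using order_isomorphism_le[OF assms] xy by metis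
qed

lemma order_isomorphism_comp:
  assumes "order_isomorphism L M h" "order_isomorphism M N g"
  shows "order_isomorphism L N (g \<circ> h)"
  using assms order_isomorphism_mem[OF assms(1)]
  by (auto simp: order_isomorphism_def intro: bij_betw_trans)

lemma order_isomorphism_cong:
  "order_isomorphism L M h \<Longrightarrow> (\<And>x. x \<in> carrier L \<Longrightarrow> g x = h x) \<Longrightarrow> order_isomorphism L M g"
  unfolding order_isomorphism_def by (metis bij_betw_cong)

lemma carrier_order_AutoGroup:
  "\<phi> \<in> carrier (order_AutoGroup L) \<longleftrightarrow> \<phi> \<in> extensional (carrier L) \<and> order_isomorphism L L \<phi>"
  by (auto simp: order_AutoGroup_def Bij_def order_isomorphism_def)

lemma mult_order_AutoGroup:
  assumes "\<phi> \<in> carrier (order_AutoGroup L)" "\<psi> \<in> carrier (order_AutoGroup L)"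
  shows "\<phi> \<otimes>\<^bsub>order_AutoGroup L\<^esub> \<psi> = compose (carrier L) \<phi> \<psi>"
  using assms by (auto simp: order_AutoGroup_def BijGroup_def)

text \<open>The isomorphism is conjugation by \<open>h\<close>. The restrictions to the carriers
  make the conjugates extensional, as the elements of these groups are.\<close>

lemma order_AutoGroup_iso:
  assumes h: "order_isomorphism L M h"
  shows "order_AutoGroup L \<cong> order_AutoGroup M"
proof -
  define k where "k = inv_into (carrier L) h"
  have k: "order_isomorphism M L k"
    unfolding k_def by (rule order_isomorphism_inv[OF h])
  have kh: "k (h x) = x" if "x \<in> carrier L" for x
    using that order_isomorphism_bij[OF h] by (simp add: k_def bij_betw_def)
  have hk: "h (k x) = x" if "x \<in> carrier M" for x
    using that order_isomorphism_bij[OF h] by (simp add: k_def bij_betw_def f_inv_into_f)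
  define F where "F = (\<lambda>\<phi>. restrict (h \<circ> \<phi> \<circ> k) (carrier M))"
  define E where "E = (\<lambda>\<phi>. restrict (k \<circ> \<phi> \<circ> h) (carrier L))"
  note mem = order_isomorphism_mem
  have F: "F \<phi> \<in> carrier (order_AutoGroup M)" if "\<phi> \<in> carrier (order_AutoGroup L)" for \<phi>
    using order_isomorphism_comp[OF k order_isomorphism_comp[OF _ h]] that
    unfolding carrier_order_AutoGroup F_def
    by (auto intro!: order_isomorphism_cong[where g = "restrict _ _"] simp: comp_assoc)
  have E: "E \<phi> \<in> carrier (order_AutoGroup L)" if "\<phi> \<in> carrier (order_AutoGroup M)" for \<phi>
    using order_isomorphism_comp[OF h order_isomorphism_comp[OF _ k]] that
    unfolding carrier_order_AutoGroup E_def
    by (auto intro!: order_isomorphism_cong[where g = "restrict _ _"] simp: comp_assoc)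
  have "group_isomorphisms (order_AutoGroup L) (order_AutoGroup M) F E"
    unfolding group_isomorphisms_def
  proof (intro conjI ballI homI)
    fix \<phi> \<psi> assume \<phi>: "\<phi> \<in> carrier (order_AutoGroup L)" and \<psi>: "\<psi> \<in> carrier (order_AutoGroup L)"
    have "\<psi> (k x) \<in> carrier L" if "x \<in> carrier M" for x
      using mem k \<psi> that by (metis carrier_order_AutoGroup)
    then show "F (\<phi> \<otimes>\<^bsub>order_AutoGroup L\<^esub> \<psi>) = F \<phi> \<otimes>\<^bsub>order_AutoGroup M\<^esub> F \<psi>"
      by (auto simp: mult_order_AutoGroup F \<phi> \<psi>)
         (auto simp: F_def compose_def kh mem[OF k] mem[OF h] intro!: restrict_ext)
  next
    fix \<phi> \<psi> assume \<phi>: "\<phi> \<in> carrier (order_AutoGroup M)" and \<psi>: "\<psi> \<in> carrier (order_AutoGroup M)"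
    have "\<psi> (h x) \<in> carrier M" if "x \<in> carrier L" for x
      using mem h \<psi> that by (metis carrier_order_AutoGroup)
    then show "E (\<phi> \<otimes>\<^bsub>order_AutoGroup M\<^esub> \<psi>) = E \<phi> \<otimes>\<^bsub>order_AutoGroup L\<^esub> E \<psi>"
      by (auto simp: mult_order_AutoGroup E \<phi> \<psi>)
         (auto simp: E_def compose_def hk mem[OF k] mem[OF h] intro!: restrict_ext)
  next
    fix \<phi> assume \<phi>: "\<phi> \<in> carrier (order_AutoGroup L)"
    then have "\<phi> x \<in> carrier L" if "x \<in> carrier L" for x
      using mem that by (metis carrier_order_AutoGroup)
    then show "E (F \<phi>) = \<phi>"
      using \<phi> by (auto simp: E_def F_def kh mem[OF h] carrier_order_AutoGroup
          intro!: extensionalityI[of _ "carrier L"])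
  next
    fix \<phi> assume \<phi>: "\<phi> \<in> carrier (order_AutoGroup M)"
    then have "\<phi> x \<in> carrier M" if "x \<in> carrier M" for x
      using mem that by (metis carrier_order_AutoGroup)
    then show "F (E \<phi>) = \<phi>"
      using \<phi> by (auto simp: E_def F_def hk mem[OF k] carrier_order_AutoGroup
          intro!: extensionalityI[of _ "carrier M"])
  qed (use E F in auto)
  then show ?thesis
    by (meson group_isomorphisms_imp_iso is_isoI)
qed

lemma LatAut_iso:
  assumes "group G" "group H" "G \<cong> H"
  shows "LatAut G \<cong> LatAut H"
proof -
  obtain h where h: "h \<in> iso G H" using assms(3) by (auto simp: is_iso_def)
  then have b: "bij_betw h (carrier G) (carrier H)" by (simp add: iso_def)
  define k where "k = inv_into (carrier G) h"
  have k: "k \<in> iso H G"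
    unfolding k_def using group.iso_set_sym[OF assms(1) h] .
  have sub: "N \<subseteq> carrier G" if "N \<lhd> G" for N
    using that by (simp add: normal_imp_subgroup subgroup.subset)
  have sub': "N \<subseteq> carrier H" if "N \<lhd> H" for N
    using that by (simp add: normal_imp_subgroup subgroup.subset)
  have inj: "inj_on h (carrier G)" and surj: "h ` carrier G = carrier H" using b by (auto simp: bij_betw_def)
  have "order_isomorphism (normal_subgroup_lattice G) (normal_subgroup_lattice H) ((`) h)"
  proof (rule order_isomorphismI)
    show "bij_betw ((`) h) (carrier (normal_subgroup_lattice G)) (carrier (normal_subgroup_lattice H))"
    proof (rule bij_betw_byWitness[where f' = "(`) k"])
      show "\<forall>N\<in>carrier (normal_subgroup_lattice G). k ` h ` N = N"
        using sub inv_into_image_cancel[OF inj] by (simp add: normal_subgroup_lattice_def k_def)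
      show "\<forall>N\<in>carrier (normal_subgroup_lattice H). h ` k ` N = N"
        using sub' image_inv_into_cancel[OF surj] by (simp add: normal_subgroup_lattice_def k_def)
      show "(`) h ` carrier (normal_subgroup_lattice G) \<subseteq> carrier (normal_subgroup_lattice H)"
        using iso_normal_subgroup[OF h assms(1,2)] by (auto simp: normal_subgroup_lattice_def)
      show "(`) k ` carrier (normal_subgroup_lattice H) \<subseteq> carrier (normal_subgroup_lattice G)"
        using iso_normal_subgroup[OF k assms(2,1)] by (auto simp: normal_subgroup_lattice_def)
    qed
    have "N \<subseteq> N' \<longleftrightarrow> h ` N \<subseteq> h ` N'" if "N \<subseteq> carrier G" "N' \<subseteq> carrier G" for N N'
      using image_mono inv_into_image_cancel[OF inj] that by metis
    then show "N \<sqsubseteq>\<^bsub>normal_subgroup_lattice G\<^esub> N' \<longleftrightarrow> h ` N \<sqsubseteq>\<^bsub>normal_subgroup_lattice H\<^esub> h ` N'"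
      if "N \<in> carrier (normal_subgroup_lattice G)" "N' \<in> carrier (normal_subgroup_lattice G)" for N N'
      using that sub by (simp add: normal_subgroup_lattice_def)
  qed
  then show ?thesis
    unfolding LatAut_def by (rule order_AutoGroup_iso)
qed

section \<open>Rearranging direct products\<close>

text \<open>Uncurrying flattens a product of powers, so that a tower group becomes a single product
  of symmetric groups.\<close>

lemma product_group_Sigma:
  "product_group A (\<lambda>a. product_group (B a) (G a)) \<cong> product_group (Sigma A B) (\<lambda>(a, b). G a b)"
proof -
  have "group_isomorphisms (product_group A (\<lambda>a. product_group (B a) (G a)))
     (product_group (Sigma A B) (\<lambda>(a, b). G a b))
     (\<lambda>f. \<lambda>(a, b)\<in>Sigma A B. f a b) (\<lambda>g. \<lambda>a\<in>A. \<lambda>b\<in>B a. g (a, b))"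
    unfolding group_isomorphisms_def
  proof (intro conjI ballI homI)
    fix f assume "f \<in> carrier (product_group A (\<lambda>a. product_group (B a) (G a)))"
    then show "(\<lambda>a\<in>A. \<lambda>b\<in>B a. (\<lambda>(a, b)\<in>Sigma A B. f a b) (a, b)) = f"
      by (auto simp: PiE_iff fun_eq_iff restrict_def extensional_def)
  next
    fix g assume "g \<in> carrier (product_group (Sigma A B) (\<lambda>(a, b). G a b))"
    then show "(\<lambda>(a, b)\<in>Sigma A B. (\<lambda>a\<in>A. \<lambda>b\<in>B a. g (a, b)) a b) = g"
      by (auto simp: PiE_iff fun_eq_iff restrict_def extensional_def)
  qed (auto simp: PiE_iff restrict_def fun_eq_iff extensional_def)
  then show ?thesis
    by (meson group_isomorphisms_imp_iso is_isoI)
qed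

lemma product_group_reindex:
  assumes e: "bij_betw e I' I"
  shows "product_group I G \<cong> product_group I' (\<lambda>i. G (e i))"
proof -
  define e' where "e' = inv_into I' e"
  have *: "e i \<in> I" "e' (e i) = i" if "i \<in> I'" for i
    using that e by (auto simp: e'_def bij_betw_def)
  have **: "e' i \<in> I'" "e (e' i) = i" if "i \<in> I" for i
    using that e by (auto simp: e'_def bij_betw_def inv_into_into f_inv_into_f)
  have "group_isomorphisms (product_group I G) (product_group I' (\<lambda>i. G (e i)))
     (\<lambda>f. \<lambda>i\<in>I'. f (e i)) (\<lambda>g. \<lambda>i\<in>I. g (e' i))"
    unfolding group_isomorphisms_def
  proof (intro conjI ballI homI)
    fix g assume "g \<in> carrier (product_group I' (\<lambda>i. G (e i)))"
    then show "(\<lambda>i\<in>I. g (e' i)) \<in> carrier (product_group I G)"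
      using ** by (fastforce simp: PiE_iff)
  qed (use * ** in \<open>auto simp: PiE_iff restrict_def fun_eq_iff extensional_def\<close>)
  then show ?thesis
    by (meson group_isomorphisms_imp_iso is_isoI)
qed

lemma DirProd_iso_product_group: "G \<times>\<times> H \<cong> product_group UNIV (\<lambda>b. if b then G else H)"
proof -
  have "group_isomorphisms (G \<times>\<times> H) (product_group UNIV (\<lambda>b. if b then G else H))
     (\<lambda>(x, y) b. if b then x else y) (\<lambda>f. (f True, f False))"
    unfolding group_isomorphisms_def
    by (intro conjI ballI homI) (auto simp: PiE_iff fun_eq_iff split: if_splits)
  then show ?thesis
    by (meson group_isomorphisms_imp_iso is_isoI)
qed

section \<open>Normal subgroups of products of symmetric groups\<close>

text \<open>Subsets of \<open>U\<close> encode vectors over the field with two elements, with symmetric difference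
  as addition.\<close>

definition binary_subspaces :: "'i set \<Rightarrow> 'i set set set" where
  "binary_subspaces U = {W. W \<subseteq> Pow U \<and> {} \<in> W \<and> (\<forall>v\<in>W. \<forall>w\<in>W. sym_diff v w \<in> W)}"

text \<open>A normal subgroup \<open>N\<close> of a product of symmetric groups is described by the set \<open>Y\<close> of factors of
  degree at least 3 to which it projects nontrivially, the set \<open>F\<close> of those whose alternating
  subgroup it contains, and the space \<open>W\<close> of its sign vectors. The set \<open>C\<close> consists of the factors of
  degree at least 3, \<open>B\<close> of those of degree 2 and \<open>J\<close> of those of degree 4, where the projection may
  be the Klein four-group.\<close>

definition triple_lattice :: "'i set \<Rightarrow> 'i set \<Rightarrow> 'i set \<Rightarrow> ('i set \<times> 'i set \<times> 'i set set) gorder" where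
  "triple_lattice C B J =
     \<lparr>carrier = {(Y, F, W). F \<subseteq> Y \<and> Y \<subseteq> C \<and> Y - F \<subseteq> J \<and> W \<in> binary_subspaces (F \<union> B)}, eq = (=),
      le = (\<lambda>(Y, F, W) (Y', F', W'). Y \<subseteq> Y' \<and> F \<subseteq> F' \<and> W \<subseteq> W')\<rparr>"

lemma mem_triple_lattice:
  "(Y, F, W) \<in> carrier (triple_lattice C B J) \<longleftrightarrow>
     F \<subseteq> Y \<and> Y \<subseteq> C \<and> Y - F \<subseteq> J \<and> W \<in> binary_subspaces (F \<union> B)"
  by (simp add: triple_lattice_def)

lemma le_triple_lattice:
  "(Y, F, W) \<sqsubseteq>\<^bsub>triple_lattice C B J\<^esub> (Y', F', W') \<longleftrightarrow> Y \<subseteq> Y' \<and> F \<subseteq> F' \<and> W \<subseteq> W'"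
  by (simp add: triple_lattice_def)

section \<open>Test permutations\<close>

text \<open>A test element for the component \<open>F\<close> of a triple: being even it has the
  zero sign vector, and it lies outside the Klein four-group.\<close>

definition three_cycle :: "nat \<Rightarrow> nat" where
  "three_cycle = transpose 1 2 \<circ> transpose 2 3"

lemma three_cycle:
  assumes "n \<ge> 3"
  shows "three_cycle permutes {1..n}" "evenperm three_cycle" "three_cycle \<noteq> id" "three_cycle \<notin> klein4"
proof -
  show "three_cycle permutes {1..n}"
    unfolding three_cycle_def using assms by (intro permutes_compose permutes_swap_id) auto
  show "evenperm three_cycle"
    unfolding three_cycle_def by (subst evenperm_comp) (auto simp: permutation_swap_id evenperm_swap)
  have v: "three_cycle 1 = 2" "three_cycle 2 = 3" by (simp_all add: three_cycle_def)
  show "three_cycle \<noteq> id" using v by auto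
  show "three_cycle \<notin> klein4" using v unfolding klein4_iff by auto
qed

text \<open>A test element for indices in \<open>Y - F\<close>, where the factor has degree 4 and
  contributes only its Klein four-group.\<close>

definition double_transposition :: "nat \<Rightarrow> nat" where
  "double_transposition = transpose 1 2 \<circ> transpose 3 4"

lemma double_transposition:
  "double_transposition \<in> klein4" "double_transposition \<noteq> id"
proof -
  have p: "double_transposition permutes {1..4}"
    unfolding double_transposition_def by (intro permutes_compose permutes_swap_id) auto
  have v: "double_transposition 1 = 2" "double_transposition 2 = 1"
    "double_transposition 3 = 4" "double_transposition 4 = 3"
    by (simp_all add: double_transposition_def)
  show "double_transposition \<in> klein4" using v p unfolding klein4_iff by blast
  show "double_transposition \<noteq> id" using v by auto
qed

lemma klein4_evenperm: "p \<in> klein4 \<Longrightarrow> evenperm p"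
  using klein4_subset_alt_group alt_group_carrier by blast

text \<open>The alternating group of degree at most 2 is trivial, so such factors are described by
  their signs alone.\<close>

lemma evenperm_eq_id:
  assumes "p permutes {1..n::nat}" "n \<le> 2" "evenperm p"
  shows "p = id"
proof -
  have "x \<in> {1, 2}" if "x \<in> {1..n}" for x
    using that assms(2) by (simp, linarith)
  then have "p permutes {1, 2}" by (intro permutes_subset[OF assms(1)] subsetI)
  then have "p = id \<or> p = transpose 1 2" by (rule permutes_doubleton_iff[THEN iffD1])
  moreover have "\<not> evenperm (transpose 1 (2::nat))" by (simp add: evenperm_swap)
  ultimately show ?thesis using assms(3) by metis
qed

section \<open>Normal subgroups obtained from triples\<close>

locale sym_product =
  fixes I :: "'i set" and k :: "'i \<Rightarrow> nat"
  assumes finite_I: "finite I"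
begin

definition "P = product_group I (\<lambda>i. sym_group (k i))"
definition "large = {i \<in> I. k i \<ge> 3}"
definition "twos = {i \<in> I. k i = 2}"
definition "fours = {i \<in> I. k i = 4}"

text \<open>As a map to sets under symmetric difference this is the sign homomorphism of the
  product.\<close>

definition odd_support :: "('i \<Rightarrow> nat \<Rightarrow> nat) \<Rightarrow> 'i set" where
  "odd_support f = {i \<in> I. \<not> evenperm (f i)}"

text \<open>An index in \<open>F\<close> carries no condition of its own: there only the sign vector
  is constrained. In degree 2 the sign is the whole component.\<close>

definition subgroup_of :: "'i set \<times> 'i set \<times> 'i set set \<Rightarrow> ('i \<Rightarrow> nat \<Rightarrow> nat) set" where
  "subgroup_of = (\<lambda>(Y, F, W). {f \<in> carrier P. (\<forall>i\<in>large - Y. f i = id) \<and>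
     (\<forall>i\<in>Y - F. f i \<in> klein4) \<and> odd_support f \<in> W})"

definition single :: "'i \<Rightarrow> (nat \<Rightarrow> nat) \<Rightarrow> 'i \<Rightarrow> nat \<Rightarrow> nat" where
  "single i p = (\<lambda>j\<in>I. if j = i then p else id)"

text \<open>The intersection of \<open>N\<close> with the factor \<open>i\<close>, as opposed to the
  projection of \<open>N\<close>. The two can differ, since the elements of \<open>N\<close> may be
  odd in several factors only jointly.\<close>

definition factor :: "('i \<Rightarrow> nat \<Rightarrow> nat) set \<Rightarrow> 'i \<Rightarrow> (nat \<Rightarrow> nat) set" where
  "factor N i = {p. p permutes {1..k i} \<and> single i p \<in> N}"

lemma group_P: "group P"
  unfolding P_def by (simp add: sym_group_is_group)

sublocale P: group P
  by (rule group_P)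

lemma carrier_P: "f \<in> carrier P \<longleftrightarrow> f \<in> extensional I \<and> (\<forall>i\<in>I. f i permutes {1..k i})"
  by (auto simp: P_def PiE_iff sym_group_carrier)

lemma mult_P: "f \<otimes>\<^bsub>P\<^esub> g = (\<lambda>i\<in>I. f i \<circ> g i)"
  by (simp add: P_def sym_group_mult)

lemma one_P: "\<one>\<^bsub>P\<^esub> = (\<lambda>i\<in>I. id)"
  by (simp add: P_def sym_group_one)

lemma inv_P:
  assumes "f \<in> carrier P" shows "inv\<^bsub>P\<^esub> f = (\<lambda>i\<in>I. inv' (f i))"
proof (rule P.inv_equality)
  have "inv' (f i) \<circ> f i = id" if "i \<in> I" for i
    using assms that carrier_P permutes_inv_o(2) by blast
  then show "(\<lambda>i\<in>I. inv' (f i)) \<otimes>\<^bsub>P\<^esub> f = \<one>\<^bsub>P\<^esub>"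
    by (auto simp: mult_P one_P intro!: restrict_ext)
  show "(\<lambda>i\<in>I. inv' (f i)) \<in> carrier P"
    using assms permutes_inv by (auto simp: carrier_P)
qed (rule assms)

lemma perm_P: "f \<in> carrier P \<Longrightarrow> i \<in> I \<Longrightarrow> f i permutes {1..k i}"
  by (simp add: carrier_P)

lemma permutation_P: "f \<in> carrier P \<Longrightarrow> i \<in> I \<Longrightarrow> permutation (f i)"
  using perm_P permutation_permutes by blast

lemma odd_support_mult:
  assumes "f \<in> carrier P" "g \<in> carrier P"
  shows "odd_support (f \<otimes>\<^bsub>P\<^esub> g) = sym_diff (odd_support f) (odd_support g)"
  using assms permutation_P by (auto simp: odd_support_def mult_P evenperm_comp)

lemma odd_support_inv: "f \<in> carrier P \<Longrightarrow> odd_support (inv\<^bsub>P\<^esub> f) = odd_support f"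
  using permutation_P by (auto simp: odd_support_def inv_P evenperm_inv)

lemma single_carrier: "p permutes {1..k i} \<Longrightarrow> single i p \<in> carrier P"
  by (auto simp: single_def carrier_P permutes_id)

lemma odd_support_single: "odd_support (single i p) = (if i \<in> I \<and> \<not> evenperm p then {i} else {})"
  by (auto simp: single_def odd_support_def)

lemma single_apply: "j \<in> I \<Longrightarrow> single i p j = (if j = i then p else id)"
  by (simp add: single_def)

lemma subgroup_of_normal:
  assumes T: "T \<in> carrier (triple_lattice large twos fours)"
  shows "subgroup_of T \<lhd> P"
proof -
  obtain Y F W where YFW: "T = (Y, F, W)" using prod_cases3 by blast
  have Y: "F \<subseteq> Y" "Y \<subseteq> large" "Y - F \<subseteq> fours" and W: "W \<in> binary_subspaces (F \<union> twos)"
    using T unfolding YFW mem_triple_lattice by auto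
  have Wz: "{} \<in> W" and Wd: "\<And>v w. v \<in> W \<Longrightarrow> w \<in> W \<Longrightarrow> sym_diff v w \<in> W"
    using W by (auto simp: binary_subspaces_def)
  have I: "large \<subseteq> I" "Y \<subseteq> I" using Y by (auto simp: large_def)
  have k4: "k i = 4" if "i \<in> Y - F" for i using Y that by (auto simp: fours_def)
  have mem: "f \<in> subgroup_of T \<longleftrightarrow> f \<in> carrier P \<and> (\<forall>i\<in>large - Y. f i = id) \<and>
     (\<forall>i\<in>Y - F. f i \<in> klein4) \<and> odd_support f \<in> W" for f
    by (simp add: subgroup_of_def YFW)
  have "subgroup (subgroup_of T) P"
  proof (rule P.subgroupI)
    show "subgroup_of T \<subseteq> carrier P" using mem by blast
    have "odd_support \<one>\<^bsub>P\<^esub> = {}" by (simp add: odd_support_def one_P)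
    then have "\<one>\<^bsub>P\<^esub> \<in> subgroup_of T"
      unfolding mem using I Wz id_in_klein4 P.one_closed by (auto simp: one_P)
    then show "subgroup_of T \<noteq> {}" by blast
  next
    fix f assume f: "f \<in> subgroup_of T"
    then have fP: "f \<in> carrier P" by (simp add: mem)
    show "inv\<^bsub>P\<^esub> f \<in> subgroup_of T"
    proof -
      have "(inv\<^bsub>P\<^esub> f) i = inv' (f i)" if "i \<in> I" for i using that by (simp add: inv_P fP)
      then have "\<forall>i\<in>large - Y. (inv\<^bsub>P\<^esub> f) i = id" "\<forall>i\<in>Y - F. (inv\<^bsub>P\<^esub> f) i \<in> klein4"
        using f I klein4_inv by (auto simp: mem subset_iff)
      then show ?thesis
        using f P.inv_closed[OF fP] unfolding mem odd_support_inv[OF fP] by blast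
    qed
  next
    fix f g assume f: "f \<in> subgroup_of T" and g: "g \<in> subgroup_of T"
    then have fP: "f \<in> carrier P" "g \<in> carrier P" by (simp_all add: mem)
    have "(f \<otimes>\<^bsub>P\<^esub> g) i = f i \<circ> g i" if "i \<in> I" for i using that by (simp add: mult_P)
    moreover have "odd_support (f \<otimes>\<^bsub>P\<^esub> g) \<in> W"
      using f g unfolding odd_support_mult[OF fP] mem by (auto intro: Wd)
    ultimately show "f \<otimes>\<^bsub>P\<^esub> g \<in> subgroup_of T"
      using f g fP I klein4_comp by (auto simp: mem subset_iff)
  qed
  moreover have "x \<otimes>\<^bsub>P\<^esub> h \<otimes>\<^bsub>P\<^esub> inv\<^bsub>P\<^esub> x \<in> subgroup_of T"
    if x: "x \<in> carrier P" and h: "h \<in> subgroup_of T" for x h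
  proof -
    have hP: "h \<in> carrier P" using h by (simp add: mem)
    have v: "(x \<otimes>\<^bsub>P\<^esub> h \<otimes>\<^bsub>P\<^esub> inv\<^bsub>P\<^esub> x) i = x i \<circ> h i \<circ> inv' (x i)" if "i \<in> I" for i
      using that x by (simp add: mult_P inv_P)
    have "odd_support (x \<otimes>\<^bsub>P\<^esub> h \<otimes>\<^bsub>P\<^esub> inv\<^bsub>P\<^esub> x) = odd_support h"
      using x hP by (auto simp: odd_support_mult odd_support_inv)
    moreover have "(x \<otimes>\<^bsub>P\<^esub> h \<otimes>\<^bsub>P\<^esub> inv\<^bsub>P\<^esub> x) i = id" if "i \<in> large - Y" for i
    proof -
      have "i \<in> I" "h i = id" using that I h by (auto simp: mem)
      then show ?thesis using v permutes_inv_o(1)[OF perm_P[OF x]] by simp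
    qed
    moreover have "(x \<otimes>\<^bsub>P\<^esub> h \<otimes>\<^bsub>P\<^esub> inv\<^bsub>P\<^esub> x) i \<in> klein4" if i: "i \<in> Y - F" for i
    proof -
      have "i \<in> I" "h i \<in> klein4" using i I h by (auto simp: mem)
      then show ?thesis using v klein4_conj perm_P[OF x, of i] k4[OF i] by simp
    qed
    ultimately show ?thesis using x hP h by (simp add: mem)
  qed
  ultimately show ?thesis by (simp add: P.normal_inv_iff)
qed

text \<open>Each component of a triple is recovered from the subgroup by its own test elements: a
  three-cycle in one factor for \<open>F\<close>, a double transposition in one factor of degree 4
  for the rest of \<open>Y\<close>, and a product of transpositions with prescribed odd coordinates
  for \<open>W\<close>.\<close>

lemma subgroup_of_le:
  assumes T: "T \<in> carrier (triple_lattice large twos fours)"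
    and T': "T' \<in> carrier (triple_lattice large twos fours)"
  shows "T \<sqsubseteq>\<^bsub>triple_lattice large twos fours\<^esub> T' \<longleftrightarrow> subgroup_of T \<subseteq> subgroup_of T'"
proof -
  obtain Y F W Y' F' W' where YFW: "T = (Y, F, W)" "T' = (Y', F', W')" using prod_cases3 by metis
  have Y: "F \<subseteq> Y" "Y \<subseteq> large" "Y - F \<subseteq> fours" "W \<in> binary_subspaces (F \<union> twos)"
    using T unfolding YFW mem_triple_lattice by auto
  have Y': "F' \<subseteq> Y'" "Y' \<subseteq> large" "Y' - F' \<subseteq> fours" "W' \<in> binary_subspaces (F' \<union> twos)"
    using T' unfolding YFW mem_triple_lattice by auto
  have mem: "f \<in> subgroup_of T \<longleftrightarrow> f \<in> carrier P \<and> (\<forall>i\<in>large - Y. f i = id) \<and>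
     (\<forall>i\<in>Y - F. f i \<in> klein4) \<and> odd_support f \<in> W" for f
    by (simp add: subgroup_of_def YFW)
  have mem': "f \<in> subgroup_of T' \<longleftrightarrow> f \<in> carrier P \<and> (\<forall>i\<in>large - Y'. f i = id) \<and>
     (\<forall>i\<in>Y' - F'. f i \<in> klein4) \<and> odd_support f \<in> W'" for f
    by (simp add: subgroup_of_def YFW)
  have I: "i \<in> large \<Longrightarrow> i \<in> I" for i by (simp add: large_def)
  have "Y \<subseteq> Y' \<and> F \<subseteq> F' \<and> W \<subseteq> W'" if sub: "subgroup_of T \<subseteq> subgroup_of T'"
  proof (intro conjI subsetI)
    have F_mem: "single i three_cycle \<in> subgroup_of T'" if "i \<in> F" for i
    proof -
      have i: "i \<in> large" "i \<in> I" "k i \<ge> 3" using that Y by (auto simp: large_def)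
      have "single i three_cycle \<in> subgroup_of T"
        unfolding mem using i that Y three_cycle[of "k i"] id_in_klein4
        by (auto simp: single_carrier odd_support_single single_apply large_def binary_subspaces_def)
      then show ?thesis using sub by blast
    qed
    show "i \<in> F'" if "i \<in> F" for i
    proof -
      have i: "i \<in> large" "i \<in> I" "k i \<ge> 3" using that Y by (auto simp: large_def)
      show ?thesis
        using F_mem[OF that] three_cycle[OF i(3)] single_apply[OF i(2)] i unfolding mem' by (metis DiffI)
    qed
    show "i \<in> Y'" if "i \<in> Y" for i
    proof (cases "i \<in> F")
      case True
      then show ?thesis using \<open>\<And>i. i \<in> F \<Longrightarrow> i \<in> F'\<close> Y' by blast
    next
      case False
      then have i: "i \<in> large" "i \<in> I" "k i = 4" using that Y by (auto simp: large_def fours_def)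
      have "single i double_transposition \<in> subgroup_of T"
        unfolding mem using i that False Y double_transposition id_in_klein4
          klein4_permutes[OF double_transposition(1)] klein4_evenperm[OF double_transposition(1)]
        by (auto simp: single_carrier odd_support_single single_apply large_def binary_subspaces_def)
      then have "single i double_transposition \<in> subgroup_of T'" using sub by blast
      then show ?thesis
        using double_transposition(2) single_apply[OF i(2)] i unfolding mem' by (metis DiffI)
    qed
    show "w \<in> W'" if w: "w \<in> W" for w
    proof -
      have sub_w: "w \<subseteq> F \<union> twos" using w Y by (auto simp: binary_subspaces_def)
      have wI: "i \<in> I \<and> k i \<ge> 2" if "i \<in> w" for i
        using sub_w that Y(1,2) by (fastforce simp: large_def twos_def)
      \<comment> \<open>Every coordinate in \<open>w\<close> has degree at least 2, so the
        transposition of 1 and 2 is available there.\<close>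
      define f where "f = (\<lambda>i\<in>I. if i \<in> w then transpose 1 (2::nat) else id)"
      have "f i permutes {1..k i}" if "i \<in> I" for i
        using that wI[of i] by (auto simp: f_def permutes_id intro!: permutes_swap_id)
      then have fP: "f \<in> carrier P" by (simp add: carrier_P f_def)
      have os: "odd_support f = w"
        using wI by (auto simp: odd_support_def f_def evenperm_swap)
      have "i \<notin> w" if "i \<in> large - F" for i
        using that sub_w by (auto simp: large_def twos_def)
      then have "f \<in> subgroup_of T"
        unfolding mem os using fP w Y I id_in_klein4 by (auto simp: f_def)
      then show ?thesis using sub os mem' by blast
    qed
  qed
  moreover have "subgroup_of T \<subseteq> subgroup_of T'" if "Y \<subseteq> Y'" "F \<subseteq> F'" "W \<subseteq> W'"
  proof
    fix f assume f: "f \<in> subgroup_of T"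
    \<comment> \<open>An index of \<open>Y' - F'\<close> outside \<open>Y\<close> has the identity
      as its component, which the Klein four-group contains.\<close>
    have "f i \<in> klein4" if "i \<in> Y' - F'" for i
    proof (cases "i \<in> Y")
      case True
      then show ?thesis using f that \<open>F \<subseteq> F'\<close> unfolding mem by blast
    next
      case False
      then have "i \<in> large - Y" using that Y' by blast
      then show ?thesis using f id_in_klein4 unfolding mem by simp
    qed
    then show "f \<in> subgroup_of T'"
      using f \<open>Y \<subseteq> Y'\<close> \<open>W \<subseteq> W'\<close> unfolding mem mem' by blast
  qed
  ultimately show ?thesis
    unfolding YFW(1,2) le_triple_lattice by (auto simp: YFW)
qed

section \<open>Triples obtained from normal subgroups\<close>

lemma normal_factor:
  assumes N: "N \<lhd> P" and i: "i \<in> I"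
  shows "factor N i \<lhd> sym_group (k i)"
proof -
  interpret N: normal N P by (rule N)
  have single_mult: "single i p \<otimes>\<^bsub>P\<^esub> single i q = single i (p \<circ> q)" for p q
    by (auto simp: mult_P single_def)
  have single_inv: "inv\<^bsub>P\<^esub> (single i p) = single i (inv' p)" if "p permutes {1..k i}" for p
    using single_carrier[OF that] by (auto simp: inv_P single_def)
  have "single i id = \<one>\<^bsub>P\<^esub>" by (auto simp: one_P single_def)
  then have id: "id \<in> factor N i" by (simp add: factor_def permutes_id)
  have comp: "p \<circ> q \<in> factor N i" if "p \<in> factor N i" "q \<in> factor N i" for p q
  proof -
    have "single i (p \<circ> q) \<in> N"
      using that N.m_closed[of "single i p" "single i q"] by (simp only: factor_def mem_Collect_eq single_mult)
    then show ?thesis using that by (simp add: factor_def permutes_compose)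
  qed
  have inv: "inv' p \<in> factor N i" if "p \<in> factor N i" for p
  proof -
    have p: "p permutes {1..k i}" and "single i p \<in> N" using that unfolding factor_def by blast+
    then have "single i (inv' p) \<in> N" using N.m_inv_closed[of "single i p"] by (simp only: single_inv[OF p])
    then show ?thesis using permutes_inv[OF p] unfolding factor_def by blast
  qed
  have conj: "p \<circ> q \<circ> inv' p \<in> factor N i" if p: "p permutes {1..k i}" and q: "q \<in> factor N i" for p q
  proof -
    have "single i p \<otimes>\<^bsub>P\<^esub> single i q \<otimes>\<^bsub>P\<^esub> inv\<^bsub>P\<^esub> (single i p) \<in> N"
      using q N.inv_op_closed2[OF single_carrier[OF p]] unfolding factor_def by blast
    then have "single i (p \<circ> q \<circ> inv' p) \<in> N"
      by (simp only: single_mult single_inv[OF p])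
    moreover have "p \<circ> q \<circ> inv' p permutes {1..k i}"
      using p q by (simp add: factor_def permutes_compose permutes_inv)
    ultimately show ?thesis by (simp add: factor_def)
  qed
  interpret S: group "sym_group (k i)" by (rule sym_group_is_group)
  have sub: "factor N i \<subseteq> carrier (sym_group (k i))"
    unfolding factor_def using sym_group_carrier by blast
  have "subgroup (factor N i) (sym_group (k i))"
  proof (rule S.subgroupI[OF sub])
    show "inv\<^bsub>sym_group (k i)\<^esub> p \<in> factor N i" if "p \<in> factor N i" for p
      using inv[OF that] sym_group_inv_equality[OF subsetD[OF sub that]] by (simp only:)
    show "p \<otimes>\<^bsub>sym_group (k i)\<^esub> q \<in> factor N i" if "p \<in> factor N i" "q \<in> factor N i" for p q
      using comp[OF that] by (simp only: sym_group_mult)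
  qed (use id in blast)
  moreover have "p \<otimes>\<^bsub>sym_group (k i)\<^esub> q \<otimes>\<^bsub>sym_group (k i)\<^esub> inv\<^bsub>sym_group (k i)\<^esub> p \<in> factor N i"
    if p: "p \<in> carrier (sym_group (k i))" and q: "q \<in> factor N i" for p q
    using conj[OF _ q, of p] p sym_group_inv_equality[OF p] by (simp only: sym_group_mult sym_group_carrier)
  ultimately show ?thesis unfolding S.normal_inv_iff by blast
qed

text \<open>The commutator of \<open>f\<close> with \<open>single i t\<close> is trivial in every
  factor except \<open>i\<close>, so its component there lies in \<open>factor N i\<close>, whether
  or not \<open>f i\<close> does.\<close>

lemma normal_component_cases:
  assumes N: "N \<lhd> P" and f: "f \<in> N" and i: "i \<in> large"
  shows "f i = id \<or> carrier (alt_group (k i)) \<subseteq> factor N i \<or>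
     k i = 4 \<and> f i \<in> klein4 \<and> klein4 \<subseteq> factor N i"
proof (rule sym_normal_cases)
  interpret N: normal N P by (rule N)
  have iI: "i \<in> I" "k i \<ge> 3" using i by (auto simp: large_def)
  show "factor N i \<lhd> sym_group (k i)" by (rule normal_factor[OF N iI(1)])
  have fP: "f \<in> carrier P" using f N.mem_carrier by blast
  show p: "f i permutes {1..k i}" by (rule perm_P[OF fP iI(1)])
  fix t assume t: "t permutes {1..k i}"
  have s: "single i t \<in> carrier P" by (rule single_carrier[OF t])
  \<comment> \<open>Bracketed as \<open>f\<close> times a conjugate of its inverse, the commutator
    visibly lies in \<open>N\<close>.\<close>
  have "f \<otimes>\<^bsub>P\<^esub> (single i t \<otimes>\<^bsub>P\<^esub> inv\<^bsub>P\<^esub> f \<otimes>\<^bsub>P\<^esub> inv\<^bsub>P\<^esub> (single i t)) \<in> N"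
    using N.m_closed[OF f N.inv_op_closed2[OF s N.m_inv_closed[OF f]]] .
  moreover have "f \<otimes>\<^bsub>P\<^esub> (single i t \<otimes>\<^bsub>P\<^esub> inv\<^bsub>P\<^esub> f \<otimes>\<^bsub>P\<^esub> inv\<^bsub>P\<^esub> (single i t)) =
      single i (f i \<circ> t \<circ> inv' (f i) \<circ> inv' t)"
  proof
    fix j
    show "(f \<otimes>\<^bsub>P\<^esub> (single i t \<otimes>\<^bsub>P\<^esub> inv\<^bsub>P\<^esub> f \<otimes>\<^bsub>P\<^esub> inv\<^bsub>P\<^esub> (single i t))) j =
      single i (f i \<circ> t \<circ> inv' (f i) \<circ> inv' t) j"
    proof (cases "j \<in> I")
      case True
      have "f j \<circ> inv' (f j) = id" using permutes_inv_o(1)[OF perm_P[OF fP True]] .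
      then show ?thesis
        by (cases "j = i")
           (simp_all add: True iI mult_P inv_P[OF fP] inv_P[OF s] single_apply comp_assoc)
    qed (simp add: mult_P single_def)
  qed
  ultimately have "single i (f i \<circ> t \<circ> inv' (f i) \<circ> inv' t) \<in> N" by simp
  moreover have "f i \<circ> t \<circ> inv' (f i) \<circ> inv' t permutes {1..k i}"
    using p t by (simp add: permutes_compose permutes_inv)
  ultimately show "f i \<circ> t \<circ> inv' (f i) \<circ> inv' t \<in> factor N i" by (simp add: factor_def)
qed (use i in \<open>simp add: large_def\<close>)

text \<open>Finiteness of the index set lets \<open>f\<close> be assembled one coordinate at a time,
  with the identity at the coordinates not yet treated.\<close>

lemma mem_of_singles:
  assumes N: "subgroup N P" and f: "f \<in> carrier P" and single: "\<And>i. i \<in> I \<Longrightarrow> single i (f i) \<in> N"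
  shows "f \<in> N"
proof -
  interpret N: subgroup N P by (rule N)
  have "(\<lambda>i\<in>I. if i \<in> A then f i else id) \<in> N" if "finite A" "A \<subseteq> I" for A
    using that
  proof (induction A)
    case empty
    then show ?case using N.one_closed unfolding one_P by (simp only: empty_iff if_False)
  next
    case (insert a A)
    have "(\<lambda>i\<in>I. if i \<in> insert a A then f i else id) =
        single a (f a) \<otimes>\<^bsub>P\<^esub> (\<lambda>i\<in>I. if i \<in> A then f i else id)"
      using insert.hyps(2) by (auto simp: mult_P single_def intro!: restrict_ext)
    moreover have "single a (f a) \<in> N" "(\<lambda>i\<in>I. if i \<in> A then f i else id) \<in> N"
      using insert.prems insert.IH single by blast+
    ultimately show ?case
      using N.m_closed[of "single a (f a)" "\<lambda>i\<in>I. if i \<in> A then f i else id"] by (simp only:)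
  qed
  from this[OF finite_I] have "(\<lambda>i\<in>I. if i \<in> I then f i else id) \<in> N" by simp
  moreover have "(\<lambda>i\<in>I. if i \<in> I then f i else id) = f"
    using f by (auto simp: carrier_P extensional_def fun_eq_iff)
  ultimately show ?thesis by simp
qed

text \<open>For the harder inclusion an element \<open>f\<close> is divided by some \<open>g\<close>
  in \<open>N\<close> with the same sign vector. The quotient is even in every coordinate, and the
  conditions for \<open>Y\<close> and \<open>F\<close> then place each coordinate in the
  corresponding \<open>factor N i\<close>.\<close>

lemma normal_eq_subgroup_of:
  assumes N: "N \<lhd> P"
  obtains T where "T \<in> carrier (triple_lattice large twos fours)" "N = subgroup_of T"
proof -
  interpret N: normal N P by (rule N)
  \<comment> \<open>\<open>Y\<close> reads off the projections of \<open>N\<close> and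
    \<open>F\<close> its intersections with the factors. By the three cases for a component they can
    differ only in degree 4.\<close>
  define Y where "Y = {i \<in> large. \<exists>f\<in>N. f i \<noteq> id}"
  define F where "F = {i \<in> large. carrier (alt_group (k i)) \<subseteq> factor N i}"
  define W where "W = odd_support ` N"
  have I: "i \<in> I" "k i \<ge> 3" if "i \<in> large" for i using that by (auto simp: large_def)
  note cases = normal_component_cases[OF N]
  have FY: "F \<subseteq> Y"
  proof
    fix i assume i: "i \<in> F"
    then have l: "i \<in> large" by (simp add: F_def)
    have "three_cycle \<in> factor N i"
      using i three_cycle(1,2)[OF I(2)[OF l]] alt_group_carrier[of three_cycle] by (auto simp: F_def)
    then have "single i three_cycle \<in> N" by (simp add: factor_def)
    moreover have "single i three_cycle i \<noteq> id"
      using three_cycle(3)[OF I(2)[OF l]] I[OF l] by (simp add: single_apply)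
    ultimately show "i \<in> Y" using l by (auto simp: Y_def)
  qed
  have YF: "k i = 4" "klein4 \<subseteq> factor N i" if i: "i \<in> Y - F" for i
  proof -
    obtain f where "f \<in> N" "f i \<noteq> id" "i \<in> large" using i by (auto simp: Y_def)
    then show "k i = 4" "klein4 \<subseteq> factor N i" using cases[of f i] i by (auto simp: F_def)
  qed
  have klein: "f i \<in> klein4" if "i \<in> Y - F" "f \<in> N" for i f
    using cases[of f i] that id_in_klein4 by (auto simp: F_def Y_def)
  have W_sub: "W \<subseteq> Pow (F \<union> twos)"
  proof
    fix w assume "w \<in> W"
    then obtain f where f: "f \<in> N" "w = odd_support f" by (auto simp: W_def)
    have "i \<in> F \<union> twos" if "i \<in> w" for i
    proof -
      have i: "i \<in> I" "\<not> evenperm (f i)" using that f by (auto simp: odd_support_def)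
      have fP: "f \<in> carrier P" using f N.mem_carrier by blast
      have "f i \<noteq> id" using i(2) by auto
      have "k i \<noteq> 0" "k i \<noteq> 1" using perm_P[OF fP i(1)] \<open>f i \<noteq> id\<close> by auto
      then show ?thesis
      proof (cases "k i = 2")
        case False
        then have "i \<in> large" using i \<open>k i \<noteq> 0\<close> \<open>k i \<noteq> 1\<close> by (simp add: large_def)
        then show ?thesis
          using cases[OF f(1)] \<open>f i \<noteq> id\<close> i(2) klein4_evenperm by (auto simp: F_def)
      qed (use i in \<open>simp add: twos_def\<close>)
    qed
    then show "w \<in> Pow (F \<union> twos)" by blast
  qed
  have "sym_diff v w \<in> W" if "v \<in> W" "w \<in> W" for v w
  proof -
    from that(1) obtain f where f: "v = odd_support f" "f \<in> N" unfolding W_def by (rule imageE)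
    from that(2) obtain g where g: "w = odd_support g" "g \<in> N" unfolding W_def by (rule imageE)
    then have "odd_support (f \<otimes>\<^bsub>P\<^esub> g) = sym_diff v w"
      using f odd_support_mult[OF N.mem_carrier N.mem_carrier] by simp
    then show ?thesis using N.m_closed[OF f(2) g(2)] unfolding W_def by (metis imageI)
  qed
  moreover have "odd_support \<one>\<^bsub>P\<^esub> = {}" by (simp add: odd_support_def one_P)
  then have "{} \<in> W" using imageI[OF N.one_closed, of odd_support] by (simp only: W_def)
  ultimately have W: "W \<in> binary_subspaces (F \<union> twos)"
    using W_sub by (simp add: binary_subspaces_def)
  have T: "(Y, F, W) \<in> carrier (triple_lattice large twos fours)"
    unfolding mem_triple_lattice using FY W YF I by (auto simp: Y_def fours_def)
  have mem: "f \<in> subgroup_of (Y, F, W) \<longleftrightarrow> f \<in> carrier P \<and> (\<forall>i\<in>large - Y. f i = id) \<and>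
     (\<forall>i\<in>Y - F. f i \<in> klein4) \<and> odd_support f \<in> W" for f
    by (simp add: subgroup_of_def)
  have "N = subgroup_of (Y, F, W)"
  proof
    show "N \<subseteq> subgroup_of (Y, F, W)"
    proof
      fix f assume "f \<in> N"
      then show "f \<in> subgroup_of (Y, F, W)"
        unfolding mem using klein N.mem_carrier by (auto simp: Y_def W_def)
    qed
    show "subgroup_of (Y, F, W) \<subseteq> N"
    proof
      fix f assume "f \<in> subgroup_of (Y, F, W)"
      then have fP: "f \<in> carrier P" and f: "\<forall>i\<in>large - Y. f i = id" "\<forall>i\<in>Y - F. f i \<in> klein4"
        and "odd_support f \<in> W"
        unfolding mem by blast+
      \<comment> \<open>\<open>W\<close> consists of sign vectors of elements of \<open>N\<close>,
        so one of these elements has the sign vector of \<open>f\<close>.\<close>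
      then obtain g where g: "g \<in> N" "odd_support f = odd_support g" by (auto simp: W_def)
      then have gP: "g \<in> carrier P" using N.mem_carrier by blast
      define d where "d = f \<otimes>\<^bsub>P\<^esub> inv\<^bsub>P\<^esub> g"
      have dP: "d \<in> carrier P" using fP gP by (simp add: d_def)
      have d: "d i = f i \<circ> inv' (g i)" if "i \<in> I" for i
        using that gP by (simp add: d_def mult_P inv_P)
      have "odd_support d = {}"
        using fP gP g by (auto simp: d_def odd_support_mult odd_support_inv)
      then have even: "evenperm (d i)" if "i \<in> I" for i
        using that by (auto simp: odd_support_def)
      have "single i (d i) \<in> N" if i: "i \<in> I" for i
      proof -
        have one: "single i id \<in> N" using N.one_closed by (simp add: single_def one_P if_distrib cong: if_cong)
        show ?thesis
        proof (cases "i \<in> large")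
          case False
          then have "d i = id"
            using evenperm_eq_id[OF perm_P[OF dP i] _ even[OF i]] i by (simp add: large_def)
          then show ?thesis using one by simp
        next
          case l: True
          then consider "i \<in> large - Y" | "i \<in> Y - F" | "i \<in> F" by blast
          then show ?thesis
          proof cases
            case 1
            then have "f i = id" "g i = id" using f g by (auto simp: Y_def)
            then have "d i = id" using d[OF i] by simp
            then show ?thesis using one by simp
          next
            case 2
            then have "d i \<in> klein4"
              using d[OF i] f klein[OF 2 g(1)] klein4_inv klein4_comp by auto
            then show ?thesis using YF(2)[OF 2] by (auto simp: factor_def)
          next
            case 3
            then show ?thesis
              using perm_P[OF dP i] even[OF i] unfolding F_def factor_def alt_group_carrier subset_iff by blast
          qed
        qed
      qed
      then have "d \<in> N" by (rule mem_of_singles[OF N.subgroup_axioms dP])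
      then have "d \<otimes>\<^bsub>P\<^esub> g \<in> N" using g by blast
      then show "f \<in> N" using fP gP by (simp add: d_def P.m_assoc)
    qed
  qed
  then show thesis using that[OF T] by blast
qed

theorem LatAut_P_iso: "LatAut P \<cong> order_AutoGroup (triple_lattice large twos fours)"
proof -
  let ?L = "triple_lattice large twos fours"
  have inj: "T = T'" if "T \<in> carrier ?L" "T' \<in> carrier ?L" "subgroup_of T = subgroup_of T'" for T T'
    using that subgroup_of_le[OF that(1,2)] subgroup_of_le[OF that(2,1)]
    by (cases T; cases T') (auto simp: le_triple_lattice)
  have iso: "order_isomorphism ?L (normal_subgroup_lattice P) subgroup_of"
  proof (rule order_isomorphismI)
    show "bij_betw subgroup_of (carrier ?L) (carrier (normal_subgroup_lattice P))"
      unfolding bij_betw_def normal_subgroup_lattice_def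
    proof
      show "inj_on subgroup_of (carrier ?L)" by (rule inj_onI) (rule inj)
      show "subgroup_of ` carrier ?L = carrier \<lparr>carrier = {N. N \<lhd> P}, eq = (=), le = (\<subseteq>)\<rparr>"
        using subgroup_of_normal by (auto elim: normal_eq_subgroup_of)
    qed
    show "T \<sqsubseteq>\<^bsub>?L\<^esub> T' \<longleftrightarrow> subgroup_of T \<sqsubseteq>\<^bsub>normal_subgroup_lattice P\<^esub> subgroup_of T'"
      if "T \<in> carrier ?L" "T' \<in> carrier ?L" for T T'
      using subgroup_of_le[OF that] by (simp add: normal_subgroup_lattice_def)
  qed
  show ?thesis
    unfolding LatAut_def by (rule order_AutoGroup_iso[OF order_isomorphism_inv[OF iso]])
qed

end

section \<open>Automorphisms of the lattice of triples\<close>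

definition act :: "('i \<Rightarrow> 'i) \<Rightarrow> 'i set \<times> 'i set \<times> 'i set set \<Rightarrow> 'i set \<times> 'i set \<times> 'i set set" where
  "act \<sigma> = (\<lambda>(Y, F, W). (\<sigma> ` Y, \<sigma> ` F, (`) \<sigma> ` W))"

lemma act_comp: "act \<sigma> (act \<tau> x) = act (\<sigma> \<circ> \<tau>) x"
  by (cases x) (simp add: act_def image_image)

lemma act_id: "act id x = x"
  by (cases x) (simp add: act_def)

lemma binary_subspaces_image:
  assumes "inj \<sigma>" "W \<in> binary_subspaces U"
  shows "(`) \<sigma> ` W \<in> binary_subspaces (\<sigma> ` U)"
proof -
  have eq: "sym_diff (\<sigma> ` v) (\<sigma> ` w) = \<sigma> ` sym_diff v w" for v w
    by (simp add: image_Un image_set_diff[OF assms(1)])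
  have W: "\<forall>v\<in>W. \<forall>w\<in>W. sym_diff v w \<in> W" "{} \<in> W" "W \<subseteq> Pow U"
    using assms(2) by (simp_all add: binary_subspaces_def)
  have "sym_diff v w \<in> (`) \<sigma> ` W" if "v \<in> (`) \<sigma> ` W" "w \<in> (`) \<sigma> ` W" for v w
  proof -
    from that(1) obtain v' where v': "v = \<sigma> ` v'" "v' \<in> W" by (rule imageE)
    from that(2) obtain w' where w': "w = \<sigma> ` w'" "w' \<in> W" by (rule imageE)
    have "sym_diff v' w' \<in> W" using W(1) v'(2) w'(2) by simp
    then show ?thesis unfolding v'(1) w'(1) eq by (rule imageI)
  qed
  moreover have "(`) \<sigma> ` W \<subseteq> Pow (\<sigma> ` U)" using \<open>W \<subseteq> Pow U\<close> by blast
  moreover have "{} \<in> (`) \<sigma> ` W" using imageI[OF \<open>{} \<in> W\<close>, of "(`) \<sigma>"] by simp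
  ultimately show ?thesis by (simp add: binary_subspaces_def)
qed

lemma act_order_isomorphism:
  assumes \<sigma>: "\<sigma> permutes I" and J: "\<sigma> ` J = J"
  shows "order_isomorphism (triple_lattice I {} J) (triple_lattice I {} J) (act \<sigma>)"
proof (rule order_isomorphismI)
  let ?L = "triple_lattice I {} J"
  have closed: "act \<tau> x \<in> carrier ?L"
    if "x \<in> carrier ?L" and \<tau>: "\<tau> permutes I" "\<tau> ` J = J" for \<tau> x
  proof -
    obtain Y F W where x: "x = (Y, F, W)" by (rule prod_cases3)
    have i: "inj \<tau>" and I: "\<tau> ` I = I" using \<tau>(1) by (auto intro: permutes_inj simp: permutes_image)
    have m: "F \<subseteq> Y" "Y \<subseteq> I" "Y - F \<subseteq> J" "W \<in> binary_subspaces F"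
      using that(1) by (auto simp: x mem_triple_lattice)
    have "\<tau> ` Y - \<tau> ` F \<subseteq> J" using m(3) \<tau>(2) image_set_diff[OF i, of Y F] by blast
    moreover have "\<tau> ` Y \<subseteq> I" using m(2) I by blast
    ultimately show ?thesis
      using m binary_subspaces_image[OF i m(4)] by (simp add: x act_def mem_triple_lattice image_mono)
  qed
  have i\<sigma>: "inv' \<sigma> permutes I" "inv' \<sigma> ` J = J"
    using permutes_inv[OF \<sigma>] J permutes_inj[OF \<sigma>] by (metis, metis image_inv_f_f)
  show "bij_betw (act \<sigma>) (carrier ?L) (carrier ?L)"
  proof (rule bij_betw_byWitness[where f' = "act (inv' \<sigma>)"])
    show "\<forall>x\<in>carrier ?L. act (inv' \<sigma>) (act \<sigma> x) = x"
      by (simp add: act_comp permutes_inv_o[OF \<sigma>] act_id)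
    show "\<forall>x\<in>carrier ?L. act \<sigma> (act (inv' \<sigma>) x) = x"
      by (simp add: act_comp permutes_inv_o[OF \<sigma>] act_id)
  qed (use closed \<sigma> J i\<sigma> in blast)+
  fix x y
  have i: "inj \<sigma>" using \<sigma> by (rule permutes_inj)
  then have "inj ((`) \<sigma>)" by (simp add: inj_image_eq_iff inj_def)
  then show "x \<sqsubseteq>\<^bsub>?L\<^esub> y \<longleftrightarrow> act \<sigma> x \<sqsubseteq>\<^bsub>?L\<^esub> act \<sigma> y"
    using i by (cases x; cases y) (simp add: act_def le_triple_lattice inj_image_subset_iff)
qed

section \<open>Rigidity when all degrees are at least 3\<close>

locale triple_lattice_automorphism =
  fixes I J :: "'i set" and \<phi>
  assumes finite_I: "finite I" and J_I: "J \<subseteq> I"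
    and auto: "order_isomorphism (triple_lattice I {} J) (triple_lattice I {} J) \<phi>"
begin

abbreviation "L \<equiv> triple_lattice I {} J"

text \<open>Three families of probes: a triple lies above \<open>pt i\<close>, \<open>alt i\<close>
  or \<open>line w\<close> exactly when its first component contains \<open>i\<close>, its second
  contains \<open>i\<close>, or its third contains \<open>w\<close>. So the probes below an element
  determine it. As a subgroup, \<open>pt i\<close> is the Klein four-group or the alternating group
  of factor \<open>i\<close>, and \<open>line w\<close> is the least normal subgroup with the sign
  vector \<open>w\<close>.\<close>

definition pt where "pt i = ({i}, if i \<in> J then {} else {i}, {{}::'i set})"
definition alt where "alt i = ({i}, {i}, {{}::'i set})"
definition line where "line w = (w, w, {{}, w :: 'i set})"

lemma mem: "(Y, F, W) \<in> carrier L \<longleftrightarrow> F \<subseteq> Y \<and> Y \<subseteq> I \<and> Y - F \<subseteq> J \<and> W \<subseteq> Pow F \<and> {} \<in> W \<and>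
    (\<forall>v\<in>W. \<forall>w\<in>W. sym_diff v w \<in> W)"
  by (simp add: mem_triple_lattice binary_subspaces_def)

lemma pt_mem: "i \<in> I \<Longrightarrow> pt i \<in> carrier L"
  by (auto simp: pt_def mem)

lemma alt_mem: "i \<in> I \<Longrightarrow> alt i \<in> carrier L"
  by (simp add: alt_def mem)

lemma line_mem: "w \<subseteq> I \<Longrightarrow> line w \<in> carrier L"
  by (auto simp: line_def mem)

lemma pt_le: "x \<in> carrier L \<Longrightarrow> pt i \<sqsubseteq>\<^bsub>L\<^esub> x \<longleftrightarrow> i \<in> fst x"
  by (cases x) (auto simp: pt_def le_triple_lattice mem)

lemma alt_le: "x \<in> carrier L \<Longrightarrow> alt i \<sqsubseteq>\<^bsub>L\<^esub> x \<longleftrightarrow> i \<in> fst (snd x)"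
  by (cases x) (auto simp: alt_def le_triple_lattice mem)

lemma line_le: "x \<in> carrier L \<Longrightarrow> line w \<sqsubseteq>\<^bsub>L\<^esub> x \<longleftrightarrow> w \<in> snd (snd x)"
  by (cases x) (simp add: line_def le_triple_lattice mem, blast)

lemma phi_mem: "x \<in> carrier L \<Longrightarrow> \<phi> x \<in> carrier L"
  by (rule order_isomorphism_mem[OF auto])

lemma phi_le: "x \<in> carrier L \<Longrightarrow> y \<in> carrier L \<Longrightarrow> \<phi> x \<sqsubseteq>\<^bsub>L\<^esub> \<phi> y \<longleftrightarrow> x \<sqsubseteq>\<^bsub>L\<^esub> y"
  by (rule order_isomorphism_le[OF auto])

lemma phi_inj: "x \<in> carrier L \<Longrightarrow> y \<in> carrier L \<Longrightarrow> \<phi> x = \<phi> y \<longleftrightarrow> x = y"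
  using order_isomorphism_bij[OF auto] by (auto simp: bij_betw_def inj_on_def)

lemma phi_surj: "y \<in> carrier L \<Longrightarrow> \<exists>x\<in>carrier L. \<phi> x = y"
proof -
  assume "y \<in> carrier L"
  then have "y \<in> \<phi> ` carrier L" using order_isomorphism_bij[OF auto] by (simp add: bij_betw_def)
  then show ?thesis by (rule imageE) (rule bexI, simp_all)
qed

text \<open>Surjectivity lets a bounded quantifier range over images, which carries order-theoretic
  definitions along the automorphism.\<close>

lemma ball_phi: "(\<forall>y\<in>carrier L. R y) \<longleftrightarrow> (\<forall>y\<in>carrier L. R (\<phi> y))"
proof
  assume r: "\<forall>y\<in>carrier L. R (\<phi> y)"
  show "\<forall>y\<in>carrier L. R y"
  proof
    fix y assume "y \<in> carrier L"
    then obtain x where "x \<in> carrier L" "\<phi> x = y" using phi_surj by blast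
    then show "R y" using r by blast
  qed
qed (simp add: phi_mem)

lemma le_antisym: "x \<sqsubseteq>\<^bsub>L\<^esub> y \<Longrightarrow> y \<sqsubseteq>\<^bsub>L\<^esub> x \<Longrightarrow> x = y"
  by (cases x; cases y) (auto simp: le_triple_lattice)

text \<open>Minimality is expressed by quantifiers over the order alone, without naming the least
  element, so that automorphisms visibly preserve it.\<close>

definition atom where
  "atom x \<longleftrightarrow> x \<in> carrier L \<and> (\<exists>y\<in>carrier L. \<not> x \<sqsubseteq>\<^bsub>L\<^esub> y) \<and>
     (\<forall>y\<in>carrier L. y \<sqsubseteq>\<^bsub>L\<^esub> x \<longrightarrow> y = x \<or> (\<forall>z\<in>carrier L. y \<sqsubseteq>\<^bsub>L\<^esub> z))"

lemma bot_mem: "({}, {}, {{}}) \<in> carrier L"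
  by (simp add: mem)

lemma bot_le: "z \<in> carrier L \<Longrightarrow> ({}, {}, {{}}) \<sqsubseteq>\<^bsub>L\<^esub> z"
  by (cases z) (auto simp: mem le_triple_lattice)

lemma eq_bot: "x \<in> carrier L \<Longrightarrow> fst x = {} \<Longrightarrow> x = ({}, {}, {{}})"
  by (cases x) (auto simp: mem)

lemma atom_iff: "atom x \<longleftrightarrow> (\<exists>i\<in>I. x = pt i)"
proof
  assume x: "atom x"
  then have xL: "x \<in> carrier L" by (simp add: atom_def)
  have "fst x \<noteq> {}"
  proof
    assume "fst x = {}"
    then have "x = ({}, {}, {{}})" using xL eq_bot by blast
    then show False using x bot_le by (auto simp: atom_def)
  qed
  then obtain i where i: "i \<in> fst x" by blast
  then have iI: "i \<in> I" using xL by (cases x) (auto simp: mem)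
  have "pt i \<sqsubseteq>\<^bsub>L\<^esub> x" using i pt_le[OF xL] by simp
  then have "pt i = x \<or> (\<forall>z\<in>carrier L. pt i \<sqsubseteq>\<^bsub>L\<^esub> z)" using x pt_mem[OF iI] by (simp add: atom_def)
  moreover have "\<not> pt i \<sqsubseteq>\<^bsub>L\<^esub> ({}, {}, {{}})" by (simp add: pt_le[OF bot_mem])
  ultimately show "\<exists>i\<in>I. x = pt i" using iI bot_mem by blast
next
  assume "\<exists>i\<in>I. x = pt i"
  then obtain i where i: "i \<in> I" and x: "x = pt i" by blast
  have "y = x \<or> (\<forall>z\<in>carrier L. y \<sqsubseteq>\<^bsub>L\<^esub> z)" if y: "y \<in> carrier L" "y \<sqsubseteq>\<^bsub>L\<^esub> x" for y
  proof (cases "fst y = {}")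
    case True
    then show ?thesis using eq_bot[OF y(1)] bot_le by simp
  next
    case False
    then have "i \<in> fst y" using y(2) by (cases y) (auto simp: x pt_def le_triple_lattice)
    then show ?thesis using pt_le[OF y(1)] le_antisym y(2) x by blast
  qed
  moreover have "\<not> pt i \<sqsubseteq>\<^bsub>L\<^esub> ({}, {}, {{}})" by (simp add: pt_le[OF bot_mem])
  ultimately show "atom x" unfolding atom_def using pt_mem[OF i] bot_mem x by blast
qed

lemma phi_atom: "x \<in> carrier L \<Longrightarrow> atom (\<phi> x) \<longleftrightarrow> atom x"
proof -
  assume x: "x \<in> carrier L"
  have least: "(\<forall>z\<in>carrier L. \<phi> y \<sqsubseteq>\<^bsub>L\<^esub> z) \<longleftrightarrow> (\<forall>z\<in>carrier L. y \<sqsubseteq>\<^bsub>L\<^esub> z)" if "y \<in> carrier L" for y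
    using that phi_le by (subst ball_phi) auto
  have "(\<exists>y\<in>carrier L. \<not> \<phi> x \<sqsubseteq>\<^bsub>L\<^esub> y) \<longleftrightarrow> (\<exists>y\<in>carrier L. \<not> x \<sqsubseteq>\<^bsub>L\<^esub> y)"
    using least[OF x] by blast
  moreover have "(\<forall>y\<in>carrier L. y \<sqsubseteq>\<^bsub>L\<^esub> \<phi> x \<longrightarrow> y = \<phi> x \<or> (\<forall>z\<in>carrier L. y \<sqsubseteq>\<^bsub>L\<^esub> z)) \<longleftrightarrow>
     (\<forall>y\<in>carrier L. \<phi> y \<sqsubseteq>\<^bsub>L\<^esub> \<phi> x \<longrightarrow> \<phi> y = \<phi> x \<or> (\<forall>z\<in>carrier L. \<phi> y \<sqsubseteq>\<^bsub>L\<^esub> z))"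
    by (rule ball_phi)
  moreover have "\<dots> \<longleftrightarrow> (\<forall>y\<in>carrier L. y \<sqsubseteq>\<^bsub>L\<^esub> x \<longrightarrow> y = x \<or> (\<forall>z\<in>carrier L. y \<sqsubseteq>\<^bsub>L\<^esub> z))"
    by (rule ball_cong[OF refl]) (simp only: least phi_le[OF _ x] phi_inj[OF _ x])
  ultimately show ?thesis unfolding atom_def using x phi_mem by simp
qed

lemma obtain_perm:
  obtains \<sigma> where "\<sigma> permutes I" "\<And>i. i \<in> I \<Longrightarrow> \<phi> (pt i) = pt (\<sigma> i)"
proof -
  have "\<forall>i\<in>I. \<exists>j\<in>I. \<phi> (pt i) = pt j"
    using phi_atom pt_mem atom_iff by metis
  then obtain s where s: "\<And>i. i \<in> I \<Longrightarrow> s i \<in> I \<and> \<phi> (pt i) = pt (s i)"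
    by metis
  \<comment> \<open>The identity outside \<open>I\<close> is the default that
    \<open>permutes\<close> demands.\<close>
  define \<sigma> where "\<sigma> i = (if i \<in> I then s i else i)" for i
  have pt_eq: "pt i = pt j \<longleftrightarrow> i = j" for i j by (auto simp: pt_def)
  have "inj_on \<sigma> I"
  proof (rule inj_onI)
    fix i j assume ij: "i \<in> I" "j \<in> I" "\<sigma> i = \<sigma> j"
    then have "\<phi> (pt i) = \<phi> (pt j)" using s by (simp add: \<sigma>_def)
    then show "i = j" using phi_inj[OF pt_mem[OF ij(1)] pt_mem[OF ij(2)]] pt_eq by blast
  qed
  moreover have "\<sigma> ` I \<subseteq> I" using s by (auto simp: \<sigma>_def)
  ultimately have "bij_betw \<sigma> I I" using endo_inj_surj[OF finite_I] by (simp add: bij_betw_def)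
  then have "\<sigma> permutes I" by (rule bij_imp_permutes) (simp add: \<sigma>_def)
  moreover have "\<phi> (pt i) = pt (\<sigma> i)" if "i \<in> I" for i using s that by (simp add: \<sigma>_def)
  ultimately show thesis by (rule that)
qed

lemma fst_phi:
  assumes \<sigma>: "\<sigma> permutes I" "\<And>i. i \<in> I \<Longrightarrow> \<phi> (pt i) = pt (\<sigma> i)" and x: "x \<in> carrier L"
  shows "fst (\<phi> x) = \<sigma> ` fst x"
proof -
  have sub: "fst z \<subseteq> I" if "z \<in> carrier L" for z using that by (cases z) (simp add: mem)
  have *: "\<sigma> i \<in> fst (\<phi> x) \<longleftrightarrow> i \<in> fst x" if "i \<in> I" for i
    using pt_le[OF x] pt_le[OF phi_mem[OF x]] phi_le[OF pt_mem[OF that] x] \<sigma>(2)[OF that] by simp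
  show ?thesis
  proof (rule Set.set_eqI)
    fix j show "j \<in> fst (\<phi> x) \<longleftrightarrow> j \<in> \<sigma> ` fst x"
    proof (cases "j \<in> I")
      case True
      then obtain i where i: "i \<in> I" "j = \<sigma> i" using permutes_image[OF \<sigma>(1)] by blast
      then show ?thesis using *[OF i(1)] inj_image_mem_iff[OF permutes_inj[OF \<sigma>(1)]] by simp
    next
      case False
      then have "j \<notin> fst (\<phi> x)" using sub[OF phi_mem[OF x]] by blast
      moreover have "j \<notin> \<sigma> ` fst x"
        using False sub[OF x] permutes_image[OF \<sigma>(1)] by (metis image_mono subsetD)
      ultimately show ?thesis by simp
    qed
  qed
qed

text \<open>Over an index in \<open>J\<close> this is the chain of Klein, alternating and symmetric
  group; over any other index only the last two remain. The size of the fibre therefore detects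
  \<open>J\<close>.\<close>

definition fibre where "fibre i = {x \<in> carrier L. fst x = {i}}"

lemma fibre_eq:
  assumes "i \<in> I" shows "fibre i = {pt i, alt i, line {i}}"
proof
  show "fibre i \<subseteq> {pt i, alt i, line {i}}"
  proof
    fix x assume "x \<in> fibre i"
    then obtain F W where x: "x = ({i}, F, W)" "({i}, F, W) \<in> carrier L" by (cases x) (auto simp: fibre_def)
    then consider "F = {}" | "F = {i}" by (auto simp: mem)
    then show "x \<in> {pt i, alt i, line {i}}"
    proof cases
      case 1
      then have "W = {{}}" "i \<in> J" using x(2) by (auto simp: mem)
      then show ?thesis using x 1 by (simp add: pt_def)
    next
      case 2
      then have "W \<subseteq> {{}, {i}}" "{} \<in> W" using x(2) by (auto simp: mem)
      then have "W = {{}} \<or> W = {{}, {i}}" by blast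
      then show ?thesis using x 2 by (auto simp: alt_def line_def)
    qed
  qed
qed (use assms pt_mem alt_mem line_mem in \<open>auto simp: fibre_def pt_def alt_def line_def\<close>)

lemma card_fibre: "i \<in> I \<Longrightarrow> card (fibre i) = (if i \<in> J then 3 else 2)"
  by (auto simp: fibre_eq pt_def alt_def line_def card_insert_if)

lemma perm_J:
  assumes \<sigma>: "\<sigma> permutes I" "\<And>i. i \<in> I \<Longrightarrow> \<phi> (pt i) = pt (\<sigma> i)"
  shows "\<sigma> ` J = J"
proof -
  have "\<sigma> i \<in> J \<longleftrightarrow> i \<in> J" if i: "i \<in> I" for i
  proof -
    have si: "\<sigma> i \<in> I" using i permutes_in_image[OF \<sigma>(1)] by simp
    have "\<phi> ` fibre i = fibre (\<sigma> i)"
    proof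
      show "\<phi> ` fibre i \<subseteq> fibre (\<sigma> i)"
        using fst_phi[OF \<sigma>] phi_mem by (auto simp: fibre_def)
      show "fibre (\<sigma> i) \<subseteq> \<phi> ` fibre i"
      proof
        fix y assume y: "y \<in> fibre (\<sigma> i)"
        then obtain x where x: "x \<in> carrier L" "\<phi> x = y" using phi_surj[of y] unfolding fibre_def by blast
        have "\<sigma> ` fst x = \<sigma> ` {i}" using fst_phi[OF \<sigma> x(1)] x y by (simp add: fibre_def)
        then have "fst x = {i}" by (simp only: inj_image_eq_iff[OF permutes_inj[OF \<sigma>(1)]])
        then have "x \<in> fibre i" using x(1) by (simp add: fibre_def)
        then show "y \<in> \<phi> ` fibre i" using imageI[of x "fibre i" \<phi>] x(2) by simp
      qed
    qed
    moreover have "inj_on \<phi> (fibre i)" using phi_inj by (auto simp: inj_on_def fibre_def)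
    ultimately have "card (fibre (\<sigma> i)) = card (fibre i)" using card_image[of \<phi> "fibre i"] by simp
    then have "(if \<sigma> i \<in> J then 3 else 2 :: nat) = (if i \<in> J then 3 else 2)"
      by (simp only: card_fibre[OF i] card_fibre[OF si])
    then show ?thesis by (cases "i \<in> J"; cases "\<sigma> i \<in> J") simp_all
  qed
  then have sub: "\<sigma> ` J \<subseteq> J" using J_I by (intro image_subsetI) (simp add: subsetD)
  have "inj_on \<sigma> J" using permutes_inj[OF \<sigma>(1)] by (rule inj_on_subset) simp
  then show ?thesis by (rule endo_inj_surj[OF finite_subset[OF J_I finite_I] sub])
qed

text \<open>By induction on \<open>w\<close>, the element \<open>line w\<close> is fixed: the full vector \<open>w\<close> is the only one in
  \<open>Pow w\<close> that lies on no line with smaller support. Every space \<open>W\<close> is then determined by the lines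
  it contains.\<close>

lemma eq_of_fixed_atoms:
  assumes fixpt: "\<And>i. i \<in> I \<Longrightarrow> \<phi> (pt i) = pt i" and x: "x \<in> carrier L"
  shows "\<phi> x = x"
proof -
  have fst: "fst (\<phi> z) = fst z" if "z \<in> carrier L" for z
    using fst_phi[OF permutes_id _ that] fixpt by simp
  have lineI: "line {i} \<in> carrier L" if "i \<in> I" for i using that line_mem by blast
  \<comment> \<open>\<open>line {i}\<close> is the greatest element of its fibre, and an
    automorphism that preserves the fibre fixes it.\<close>
  have top: "y \<sqsubseteq>\<^bsub>L\<^esub> line {i}" if "i \<in> I" "y \<in> fibre i" for i y
    using that by (auto simp: fibre_eq pt_def alt_def line_def le_triple_lattice)
  have fix_line: "\<phi> (line {i}) = line {i}" if i: "i \<in> I" for i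
  proof -
    obtain z where z: "z \<in> carrier L" "\<phi> z = line {i}" using phi_surj lineI[OF i] by blast
    have fibre: "z \<in> fibre i" "\<phi> (line {i}) \<in> fibre i"
      using fst[OF z(1)] fst[OF lineI[OF i]] z phi_mem[OF lineI[OF i]] by (auto simp: fibre_def line_def)
    have "line {i} \<sqsubseteq>\<^bsub>L\<^esub> \<phi> (line {i})"
      using top[OF i fibre(1)] phi_le[OF z(1) lineI[OF i]] z by simp
    then show ?thesis using top[OF i fibre(2)] le_antisym by blast
  qed
  \<comment> \<open>In a fibre of three elements the other two are already fixed; in a fibre of two,
    \<open>alt i\<close> is the atom itself.\<close>
  have fix_alt: "\<phi> (alt i) = alt i" if i: "i \<in> I" for i
  proof (cases "i \<in> J")
    case True
    have "\<phi> (alt i) \<in> fibre i"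
      using fst[OF alt_mem[OF i]] phi_mem[OF alt_mem[OF i]] by (simp add: fibre_def alt_def)
    moreover have "\<phi> (alt i) \<noteq> pt i"
      using fixpt[OF i] phi_inj[OF alt_mem[OF i] pt_mem[OF i]] True by (auto simp: pt_def alt_def)
    moreover have "\<phi> (alt i) \<noteq> line {i}"
      using fix_line[OF i] phi_inj[OF alt_mem[OF i] lineI[OF i]] by (auto simp: line_def alt_def)
    ultimately show ?thesis using fibre_eq[OF i] by blast
  next
    case False
    then have "alt i = pt i" by (simp add: alt_def pt_def)
    then show ?thesis using fixpt[OF i] by simp
  qed
  have sub: "fst (snd z) \<subseteq> I" if "z \<in> carrier L" for z using that by (cases z) (auto simp: mem)
  have snd: "fst (snd (\<phi> z)) = fst (snd z)" if z: "z \<in> carrier L" for z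
  proof -
    have "i \<in> fst (snd (\<phi> z)) \<longleftrightarrow> i \<in> fst (snd z)" if i: "i \<in> I" for i
      using alt_le[OF z] alt_le[OF phi_mem[OF z]] phi_le[OF alt_mem[OF i] z] fix_alt[OF i] by metis
    then show ?thesis using sub[OF z] sub[OF phi_mem[OF z]] by blast
  qed
  have lines: "\<phi> (line w) = line w" if "w \<subseteq> I" for w
    using finite_subset[OF that finite_I] that
  proof (induction w rule: finite_psubset_induct)
    case (psubset w)
    note wL = line_mem[OF psubset.prems]
    obtain W where W: "\<phi> (line w) = (w, w, W)" 
      using fst[OF wL] snd[OF wL] by (cases "\<phi> (line w)") (auto simp: line_def)
    then have m: "(w, w, W) \<in> carrier L" using phi_mem[OF wL] by simp
    \<comment> \<open>A nonzero vector \<open>u\<close> other than \<open>w\<close> in the image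
      would put the fixed element \<open>line u\<close> below \<open>line w\<close>, whose only
      nonzero vector is \<open>w\<close>.\<close>
    have "u = w" if u: "u \<in> W" "u \<noteq> {}" for u
    proof (rule ccontr)
      assume "u \<noteq> w"
      moreover have "u \<subseteq> w" using u(1) m unfolding mem by blast
      ultimately have "u \<subset> w" by blast
      then have fu: "\<phi> (line u) = line u" and uL: "line u \<in> carrier L"
        using psubset line_mem by auto
      have "line u \<sqsubseteq>\<^bsub>L\<^esub> (w, w, W)" using line_le[OF m] u by simp
      then have "line u \<sqsubseteq>\<^bsub>L\<^esub> line w" using fu phi_le[OF uL wL] W by simp
      then show False using line_le[OF wL] u \<open>u \<noteq> w\<close> by (simp add: line_def)
    qed
    moreover have "{} \<in> W" using m by (simp add: mem)
    ultimately have "W = {{}} \<or> W = {{}, w}" by blast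
    \<comment> \<open>If \<open>line w\<close> were sent to \<open>(w, w, {{}})\<close>, the image
      of \<open>(w, w, {{}})\<close> would lie below this element and agree with it in the first two
      components. Both would then have the same image, against injectivity.\<close>
    moreover have "W \<noteq> {{}}" if "w \<noteq> {}"
    proof
      assume W0: "W = {{}}"
      have aL: "(w, w, {{}}) \<in> carrier L" using psubset.prems by (simp add: mem)
      have "(w, w, {{}}) \<sqsubseteq>\<^bsub>L\<^esub> line w" by (simp add: line_def le_triple_lattice)
      then have le: "\<phi> (w, w, {{}}) \<sqsubseteq>\<^bsub>L\<^esub> (w, w, {{}})"
        using phi_le[OF aL wL] W W0 by simp
      obtain V where V: "\<phi> (w, w, {{}}) = (w, w, V)"
        using fst[OF aL] snd[OF aL] by (cases "\<phi> (w, w, {{}})") auto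
      then have "{} \<in> V" using phi_mem[OF aL] by (simp add: mem)
      then have "V = {{}}" using le V by (auto simp: le_triple_lattice)
      then have "(w, w, {{}}) = line w" using phi_inj[OF aL wL] V W W0 by simp
      then show False using that by (simp add: line_def)
    qed
    ultimately show ?case using W by (auto simp: line_def)
  qed
  have "snd (snd (\<phi> x)) = snd (snd x)"
  proof -
    have "w \<in> snd (snd (\<phi> x)) \<longleftrightarrow> w \<in> snd (snd x)" if w: "w \<subseteq> I" for w
      using line_le[OF x] line_le[OF phi_mem[OF x]] phi_le[OF line_mem[OF w] x] lines[OF w] by metis
    moreover have "w \<subseteq> I" if "z \<in> carrier L" "w \<in> snd (snd z)" for z w
      using that by (cases z) (simp add: mem, blast)
    ultimately show ?thesis using x phi_mem[OF x] by blast
  qed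
  then show ?thesis using fst[OF x] snd[OF x] by (simp add: prod_eq_iff)
qed

end

text \<open>Composing with the action of the inverse permutation reduces to an automorphism that
  fixes all atoms.\<close>

lemma triple_lattice_automorphism_eq_act:
  assumes "finite I" "J \<subseteq> I"
    and auto: "order_isomorphism (triple_lattice I {} J) (triple_lattice I {} J) \<phi>"
  obtains \<sigma> where "\<sigma> permutes I" "\<sigma> ` J = J" "\<And>x. x \<in> carrier (triple_lattice I {} J) \<Longrightarrow> \<phi> x = act \<sigma> x"
proof -
  interpret A: triple_lattice_automorphism I J \<phi>
    by unfold_locales (use assms in auto)
  obtain \<sigma> where \<sigma>: "\<sigma> permutes I" "\<And>i. i \<in> I \<Longrightarrow> \<phi> (A.pt i) = A.pt (\<sigma> i)"
    using A.obtain_perm by blast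
  have J: "\<sigma> ` J = J" by (rule A.perm_J[OF \<sigma>])
  have i\<sigma>: "inv' \<sigma> permutes I" "inv' \<sigma> ` J = J"
    using permutes_inv[OF \<sigma>(1)] J permutes_inj[OF \<sigma>(1)] by (metis, metis image_inv_f_f)
  define \<psi> where "\<psi> = act (inv' \<sigma>) \<circ> \<phi>"
  interpret B: triple_lattice_automorphism I J \<psi>
    unfolding \<psi>_def
    by unfold_locales (use assms order_isomorphism_comp[OF auto act_order_isomorphism[OF i\<sigma>]] in auto)
  have "\<psi> (A.pt i) = A.pt i" if "i \<in> I" for i
  proof -
    have "\<sigma> i \<in> J \<longleftrightarrow> i \<in> J"
      using J permutes_inj[OF \<sigma>(1)] by (metis inj_image_mem_iff)
    then show ?thesis
      using \<sigma>(2)[OF that] permutes_inverses[OF \<sigma>(1)] by (simp add: \<psi>_def A.pt_def act_def)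
  qed
  then have "\<psi> x = x" if "x \<in> carrier A.L" for x
    using B.eq_of_fixed_atoms that by simp
  then have "act (inv' \<sigma>) (\<phi> x) = x" if "x \<in> carrier A.L" for x
    using that by (simp add: \<psi>_def)
  then have "act \<sigma> (act (inv' \<sigma>) (\<phi> x)) = act \<sigma> x" if "x \<in> carrier A.L" for x
    using that by simp
  then have "\<phi> x = act \<sigma> x" if "x \<in> carrier A.L" for x
    using that by (simp add: act_comp permutes_inv_o[OF \<sigma>(1)] act_id)
  then show thesis using that \<sigma>(1) J by blast
qed

section \<open>The automorphism group as a product of two symmetric groups\<close>

text \<open>\<open>D\<close> is a disjoint union of two sets and \<open>J\<close> its part tagged
  \<open>True\<close>. A permutation of \<open>D\<close> that preserves \<open>J\<close> preserves
  the tags, so it amounts to a pair of permutations.\<close>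

lemma product_sym_group_iso_order_AutoGroup:
  fixes c :: "bool \<Rightarrow> nat"
  defines "D \<equiv> SIGMA b:UNIV. {1..c b}"
  defines "J \<equiv> {True} \<times> {1..c True}"
  shows "product_group UNIV (\<lambda>b. sym_group (c b)) \<cong> order_AutoGroup (triple_lattice D {} J)"
proof -
  let ?P = "product_group UNIV (\<lambda>b. sym_group (c b))" and ?L = "triple_lattice D {} J"
  define t where "t = (\<lambda>(\<pi> :: bool \<Rightarrow> nat \<Rightarrow> nat) (b, i). (b, \<pi> b i))"
  have P: "\<pi> \<in> carrier ?P \<longleftrightarrow> (\<forall>b. \<pi> b permutes {1..c b})" for \<pi>
    by (auto simp: PiE_iff sym_group_carrier)
  have finD: "finite D" and JD: "J \<subseteq> D" by (auto simp: D_def J_def)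
  have t_perm: "t \<pi> permutes D" "t \<pi> ` J = J" if "\<pi> \<in> carrier ?P" for \<pi>
  proof -
    have p: "\<pi> b permutes {1..c b}" for b using that P by blast
    have sub: "t \<pi> ` D \<subseteq> D" "t \<pi> ` J \<subseteq> J"
      using permutes_in_image[OF p] by (force simp: t_def D_def J_def)+
    have inj: "inj (t \<pi>)"
      using permutes_inj[OF p] by (auto simp: t_def inj_def)
    have "bij_betw (t \<pi>) D D"
      using endo_inj_surj[OF finD sub(1)] inj_on_subset[OF inj subset_UNIV] by (simp add: bij_betw_def)
    moreover have "t \<pi> x = x" if "x \<notin> D" for x
      using that permutes_not_in[OF p] by (cases x) (simp add: t_def D_def)
    ultimately show "t \<pi> permutes D" by (rule bij_imp_permutes)
    show "t \<pi> ` J = J"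
      by (rule endo_inj_surj[OF finite_subset[OF JD finD] sub(2) inj_on_subset[OF inj subset_UNIV]])
  qed
  define \<Theta> where "\<Theta> \<pi> = restrict (act (t \<pi>)) (carrier ?L)" for \<pi>
  have \<Theta>_mem: "\<Theta> \<pi> \<in> carrier (order_AutoGroup ?L)" if "\<pi> \<in> carrier ?P" for \<pi>
    unfolding carrier_order_AutoGroup \<Theta>_def
    using order_isomorphism_cong[OF act_order_isomorphism[OF t_perm[OF that]]] by simp
  \<comment> \<open>The image of the atom over \<open>x\<close> reveals the image of
    \<open>x\<close>, so the action is faithful.\<close>
  have pt: "({x}, if x \<in> J then {} else {x}, {{}}) \<in> carrier ?L" if "x \<in> D" for x
    using that by (auto simp: mem_triple_lattice binary_subspaces_def)
  have inj: "\<pi> = \<pi>'" if "\<pi> \<in> carrier ?P" "\<pi>' \<in> carrier ?P" "\<Theta> \<pi> = \<Theta> \<pi>'" for \<pi> \<pi>'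
  proof (intro ext)
    fix b i
    show "\<pi> b i = \<pi>' b i"
    proof (cases "(b, i) \<in> D")
      case True
      then have "act (t \<pi>) ({(b, i)}, if (b, i) \<in> J then {} else {(b, i)}, {{}}) =
          act (t \<pi>') ({(b, i)}, if (b, i) \<in> J then {} else {(b, i)}, {{}})"
        using fun_cong[OF that(3)] pt[OF True] unfolding \<Theta>_def by (metis restrict_apply')
      then show ?thesis by (simp add: act_def t_def)
    next
      case False
      then have "i \<notin> {1..c b}" by (simp add: D_def)
      moreover have "\<pi> b permutes {1..c b}" "\<pi>' b permutes {1..c b}" using that P by blast+
      ultimately show ?thesis by (metis permutes_not_in)
    qed
  qed
  have surj: "\<exists>\<pi>\<in>carrier ?P. \<phi> = \<Theta> \<pi>" if \<phi>: "\<phi> \<in> carrier (order_AutoGroup ?L)" for \<phi>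
  proof -
    obtain \<sigma> where \<sigma>: "\<sigma> permutes D" "\<sigma> ` J = J" and act: "\<And>x. x \<in> carrier ?L \<Longrightarrow> \<phi> x = act \<sigma> x"
      using triple_lattice_automorphism_eq_act[OF finD JD] \<phi> unfolding carrier_order_AutoGroup by metis
    define \<pi> where "\<pi> = (\<lambda>b i. snd (\<sigma> (b, i)))"
    have fst: "fst (\<sigma> (b, i)) = b" for b i
    proof (cases "(b, i) \<in> D")
      case True
      have "\<sigma> (b, i) \<in> D" "\<sigma> (b, i) \<in> J \<longleftrightarrow> (b, i) \<in> J"
        using True permutes_in_image[OF \<sigma>(1)] inj_image_mem_iff[OF permutes_inj[OF \<sigma>(1)], of _ J] \<sigma>(2)
        by auto
      then show ?thesis using True by (cases "\<sigma> (b, i)"; cases b) (auto simp: J_def D_def)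
    qed (simp add: permutes_not_in[OF \<sigma>(1)])
    have eq: "\<sigma> (b, i) = (b, \<pi> b i)" for b i
      using fst[of b i] by (simp add: \<pi>_def prod_eq_iff)
    then have t: "t \<pi> = \<sigma>" by (simp add: t_def fun_eq_iff)
    have "\<pi> b permutes {1..c b}" for b
    proof (rule bij_imp_permutes)
      have "inj_on (\<pi> b) {1..c b}"
        by (rule inj_onI, rule Pair_inject[OF injD[OF permutes_inj[OF \<sigma>(1)]], of b _ b]) (simp_all add: eq)
      moreover have "\<pi> b i \<in> {1..c b}" if "i \<in> {1..c b}" for i
        using that eq[of b i] permutes_in_image[OF \<sigma>(1), of "(b, i)"] by (simp add: D_def)
      ultimately show "bij_betw (\<pi> b) {1..c b} {1..c b}"
        unfolding bij_betw_def
        using endo_inj_surj[OF finite_atLeastAtMost image_subsetI] by blast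
      show "\<pi> b i = i" if "i \<notin> {1..c b}" for i
        using that eq[of b i] permutes_not_in[OF \<sigma>(1), of "(b, i)"] by (simp add: D_def)
    qed
    then have "\<pi> \<in> carrier ?P" using P by blast
    moreover have "\<phi> = \<Theta> \<pi>"
      using act \<phi> unfolding \<Theta>_def t carrier_order_AutoGroup
      by (intro extensionalityI[of _ "carrier ?L"]) auto
    ultimately show ?thesis by blast
  qed
  have "\<Theta> \<in> iso ?P (order_AutoGroup ?L)"
  proof (rule isoI)
    show "\<Theta> \<in> hom ?P (order_AutoGroup ?L)"
    proof (rule homI)
      fix \<pi> \<pi>' assume \<pi>: "\<pi> \<in> carrier ?P" "\<pi>' \<in> carrier ?P"
      have "t (\<pi> \<otimes>\<^bsub>?P\<^esub> \<pi>') = t \<pi> \<circ> t \<pi>'"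
        by (simp add: t_def fun_eq_iff sym_group_mult)
      moreover have "act (t \<pi>') x \<in> carrier ?L" if "x \<in> carrier ?L" for x
        using order_isomorphism_mem[OF act_order_isomorphism[OF t_perm[OF \<pi>(2)]] that] .
      ultimately show "\<Theta> (\<pi> \<otimes>\<^bsub>?P\<^esub> \<pi>') = \<Theta> \<pi> \<otimes>\<^bsub>order_AutoGroup ?L\<^esub> \<Theta> \<pi>'"
        unfolding mult_order_AutoGroup[OF \<Theta>_mem[OF \<pi>(1)] \<Theta>_mem[OF \<pi>(2)]]
        by (auto simp: \<Theta>_def compose_def act_comp intro!: restrict_ext)
    qed (rule \<Theta>_mem)
    show "bij_betw \<Theta> (carrier ?P) (carrier (order_AutoGroup ?L))"
      unfolding bij_betw_def
    proof
      show "inj_on \<Theta> (carrier ?P)" by (rule inj_onI) (rule inj)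
      show "\<Theta> ` carrier ?P = carrier (order_AutoGroup ?L)"
      proof
        show "\<Theta> ` carrier ?P \<subseteq> carrier (order_AutoGroup ?L)"
          using \<Theta>_mem by (rule image_subsetI)
        show "carrier (order_AutoGroup ?L) \<subseteq> \<Theta> ` carrier ?P"
        proof
          fix \<phi> assume "\<phi> \<in> carrier (order_AutoGroup ?L)"
          from surj[OF this] show "\<phi> \<in> \<Theta> ` carrier ?P" by (elim bexE) (simp only: imageI)
        qed
      qed
    qed
  qed
  then show ?thesis by (rule is_isoI)
qed

section \<open>Small lattices\<close>

definition down :: "('a, 'b) gorder_scheme \<Rightarrow> 'a \<Rightarrow> 'a set" where
  "down L x = {y \<in> carrier L. y \<sqsubseteq>\<^bsub>L\<^esub> x}"

definition up :: "('a, 'b) gorder_scheme \<Rightarrow> 'a \<Rightarrow> 'a set" where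
  "up L x = {y \<in> carrier L. x \<sqsubseteq>\<^bsub>L\<^esub> y}"

lemma card_down_up:
  assumes \<phi>: "order_isomorphism L L \<phi>" and x: "x \<in> carrier L"
  shows "card (down L (\<phi> x)) = card (down L x)" "card (up L (\<phi> x)) = card (up L x)"
proof -
  have inj: "inj_on \<phi> (carrier L)" and surj: "\<phi> ` carrier L = carrier L"
    using order_isomorphism_bij[OF \<phi>] by (auto simp: bij_betw_def)
  note le = order_isomorphism_le[OF \<phi>]
  have "down L (\<phi> x) = {y \<in> \<phi> ` carrier L. y \<sqsubseteq>\<^bsub>L\<^esub> \<phi> x}" by (simp add: down_def surj)
  also have "\<dots> = \<phi> ` down L x" using le x by (auto simp: down_def)
  finally show "card (down L (\<phi> x)) = card (down L x)"
    using card_image[OF inj_on_subset[OF inj], of "down L x"] by (simp add: down_def)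
  have "up L (\<phi> x) = {y \<in> \<phi> ` carrier L. \<phi> x \<sqsubseteq>\<^bsub>L\<^esub> y}" by (simp add: up_def surj)
  also have "\<dots> = \<phi> ` up L x" using le x by (auto simp: up_def)
  finally show "card (up L (\<phi> x)) = card (up L x)"
    using card_image[OF inj_on_subset[OF inj], of "up L x"] by (simp add: up_def)
qed

lemma id_mem_order_AutoGroup: "restrict id (carrier L) \<in> carrier (order_AutoGroup L)"
  by (simp add: carrier_order_AutoGroup order_isomorphism_def bij_betw_def inj_on_def image_restrict_eq)

text \<open>An automorphism preserves the size of a principal ideal. Among nested finite sets the
  size determines the set, and the ideal determines its element.\<close>

lemma trivial_order_AutoGroup_chain:
  assumes fin: "finite (carrier L)" and grp: "group (order_AutoGroup L)"
    and total: "\<And>x y. x \<in> carrier L \<Longrightarrow> y \<in> carrier L \<Longrightarrow> down L x \<subseteq> down L y \<or> down L y \<subseteq> down L x"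
    and inj: "inj_on (down L) (carrier L)"
  shows "trivial_group (order_AutoGroup L)"
proof -
  have "\<phi> = restrict id (carrier L)" if \<phi>: "\<phi> \<in> carrier (order_AutoGroup L)" for \<phi>
  proof (rule extensionalityI[of _ "carrier L"])
    have iso: "order_isomorphism L L \<phi>" using \<phi> by (simp add: carrier_order_AutoGroup)
    fix x assume x: "x \<in> carrier L"
    note m = order_isomorphism_mem[OF iso x]
    have "finite (down L y)" for y using fin by (simp add: down_def)
    then have "down L (\<phi> x) = down L x"
      using card_down_up(1)[OF iso x] total[OF m x] card_subset_eq by metis
    then show "\<phi> x = restrict id (carrier L) x" using inj_onD[OF inj _ m x] x by simp
  qed (use \<phi> in \<open>auto simp: carrier_order_AutoGroup\<close>)
  then have "carrier (order_AutoGroup L) = {restrict id (carrier L)}"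
    using id_mem_order_AutoGroup by blast
  then show ?thesis using group.trivial_group[OF grp] by blast
qed

lemma trivial_LatAut_of_chain:
  assumes "finite (carrier G)"
    and chain: "\<And>N N'. N \<lhd> G \<Longrightarrow> N' \<lhd> G \<Longrightarrow> N \<subseteq> N' \<or> N' \<subseteq> N"
  shows "trivial_group (LatAut G)"
  unfolding LatAut_def
proof (rule trivial_order_AutoGroup_chain)
  have "{N. N \<lhd> G} \<subseteq> Pow (carrier G)"
    using normal_imp_subgroup subgroup.subset by blast
  then show "finite (carrier (normal_subgroup_lattice G))"
    using assms(1) by (simp add: normal_subgroup_lattice_def finite_subset)
  show "group (order_AutoGroup (normal_subgroup_lattice G))"
    using group_LatAut by (simp add: LatAut_def)
  show "down (normal_subgroup_lattice G) N \<subseteq> down (normal_subgroup_lattice G) N' \<or>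
      down (normal_subgroup_lattice G) N' \<subseteq> down (normal_subgroup_lattice G) N"
    if "N \<in> carrier (normal_subgroup_lattice G)" "N' \<in> carrier (normal_subgroup_lattice G)" for N N'
    using that chain[of N N'] by (auto simp: down_def normal_subgroup_lattice_def)
  show "inj_on (down (normal_subgroup_lattice G)) (carrier (normal_subgroup_lattice G))"
    by (rule inj_onI) (auto simp: down_def normal_subgroup_lattice_def set_eq_iff)
qed

lemma trivial_LatAut_of_card_le_2:
  assumes "group G" "finite (carrier G)" "card (carrier G) \<le> 2"
  shows "trivial_group (LatAut G)"
proof (rule trivial_LatAut_of_chain[OF assms(2)])
  interpret group G by (rule assms(1))
  have "N = {\<one>\<^bsub>G\<^esub>} \<or> N = carrier G" if "N \<lhd> G" for N
  proof (rule disjCI)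
    assume ne: "N \<noteq> carrier G"
    have sub: "N \<subseteq> carrier G" "\<one>\<^bsub>G\<^esub> \<in> N"
      using that normal_imp_subgroup subgroup.subset subgroup.one_closed by blast+
    have "card N < card (carrier G)" using psubset_card_mono[OF assms(2)] sub ne by blast
    then have "card N \<le> 1" using assms(3) by simp
    then show "N = {\<one>\<^bsub>G\<^esub>}" using sub finite_subset[OF sub(1) assms(2)] card_le_Suc0_iff_eq[of N] by auto
  qed
  moreover have "\<one>\<^bsub>G\<^esub> \<in> N" if "N \<lhd> G" for N
    using that normal_imp_subgroup subgroup.one_closed by blast
  moreover have "N \<subseteq> carrier G" if "N \<lhd> G" for N
    using that normal_imp_subgroup subgroup.subset by blast
  ultimately show "N \<subseteq> N' \<or> N' \<subseteq> N" if "N \<lhd> G" "N' \<lhd> G" for N N'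
    using that by (metis empty_subsetI insert_subset)
qed

lemma finite_sym_group: "finite (carrier (sym_group n))"
  by (simp add: sym_group_def finite_permutations)

text \<open>A nontrivial normal subgroup contains the alternating group, which has index 2, so one
  odd element already yields the whole group. This leaves a chain.\<close>

lemma trivial_LatAut_sym_group_3: "trivial_group (LatAut (sym_group 3))"
proof (rule trivial_LatAut_of_chain[OF finite_sym_group])
  have cases: "N = {id} \<or> carrier (alt_group 3) \<subseteq> N" if N: "N \<lhd> sym_group 3" for N
  proof (rule disjCI)
    assume "\<not> carrier (alt_group 3) \<subseteq> N"
    moreover have "h = id \<or> carrier (alt_group 3) \<subseteq> N" if h: "h \<in> N" for h
    proof -
      have hp: "h permutes {1..3}" by (rule sym_normal_sub[OF N h])
      have inv: "inv' h \<in> N"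
        using subgroup.m_inv_closed[OF normal_imp_subgroup[OF N] h] sym_group_inv_equality hp
        by (metis sym_group_carrier)
      have "h \<circ> t \<circ> inv' h \<circ> inv' t \<in> N" if "t permutes {1..3}" for t
        using sym_normal_comp[OF N h sym_normal_conj[OF N inv that]] by (simp only: comp_assoc)
      then show ?thesis using sym_normal_cases[OF N _ hp] by fastforce
    qed
    moreover have "id \<in> N"
      using subgroup.one_closed[OF normal_imp_subgroup[OF N]] by (simp add: sym_group_one)
    ultimately show "N = {id}" by blast
  qed
  have id: "id \<in> N" if N: "N \<lhd> sym_group 3" for N
    using subgroup.one_closed[OF normal_imp_subgroup[OF N]] by (simp add: sym_group_one)
  have all: "q \<in> N" if N: "N \<lhd> sym_group 3" and A: "carrier (alt_group 3) \<subseteq> N" and p: "p \<in> N" "\<not> evenperm p"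
    and q: "q permutes {1..3}" for N p q
  proof (cases "evenperm q")
    case True
    then show ?thesis using A q alt_group_carrier by blast
  next
    case False
    have pp: "p permutes {1..3}" by (rule sym_normal_sub[OF N p(1)])
    have perm: "permutation p" "permutation q" "permutation (inv' p)"
      using pp q permutes_inv[OF pp] by (metis finite_atLeastAtMost permutation_permutes)+
    have "evenperm (q \<circ> inv' p)"
      using False p(2) perm by (simp add: evenperm_comp evenperm_inv)
    then have "q \<circ> inv' p \<in> N"
      using A permutes_compose[OF permutes_inv[OF pp] q] alt_group_carrier by blast
    then have "q \<circ> inv' p \<circ> p \<in> N" using sym_normal_comp[OF N] p(1) by blast
    then show ?thesis by (simp add: comp_assoc permutes_inv_o[OF pp])
  qed
  fix N N' assume N: "N \<lhd> sym_group 3" and N': "N' \<lhd> sym_group 3"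
  show "N \<subseteq> N' \<or> N' \<subseteq> N"
  proof (cases "N = {id} \<or> N' = {id}")
    case True
    then show ?thesis using id[OF N] id[OF N'] by blast
  next
    case False
    then have A: "carrier (alt_group 3) \<subseteq> N" "carrier (alt_group 3) \<subseteq> N'" using cases N N' by blast+
    show ?thesis
    proof (cases "\<exists>p\<in>N. \<not> evenperm p")
      case True
      then show ?thesis using all[OF N A(1)] sym_normal_sub[OF N'] by blast
    next
      case False
      then have "N \<subseteq> carrier (alt_group 3)"
        using sym_normal_sub[OF N] alt_group_carrier by blast
      then show ?thesis using A(2) by blast
    qed
  qed
qed

section \<open>Lattices with at most two automorphisms\<close>

text \<open>The sizes of ideal and filter pin down all elements except possibly \<open>s\<close> and
  \<open>s'\<close>, and these two can only be permuted. An automorphism is therefore determined by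
  its value at \<open>s\<close>.\<close>

lemma card_order_AutoGroup_le_2:
  assumes sep: "\<And>x y. x \<in> carrier L \<Longrightarrow> y \<in> carrier L \<Longrightarrow> x \<notin> {s, s'} \<Longrightarrow>
      card (down L x) = card (down L y) \<Longrightarrow> card (up L x) = card (up L y) \<Longrightarrow> x = y"
    and s: "s \<in> carrier L" "s' \<in> carrier L"
  shows "finite (carrier (order_AutoGroup L)) \<and> card (carrier (order_AutoGroup L)) \<le> 2"
proof -
  have fixed: "\<phi> x = x" if "order_isomorphism L L \<phi>" "x \<in> carrier L" "x \<notin> {s, s'}" for \<phi> x
    using sep[OF that(2) order_isomorphism_mem[OF that(1,2)] that(3)] card_down_up[OF that(1,2)] by simp
  have moved: "\<phi> x \<in> {s, s'}" if "order_isomorphism L L \<phi>" "x \<in> {s, s'}" for \<phi> x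
  proof (rule ccontr)
    have x: "x \<in> carrier L" using that(2) s by blast
    assume ne: "\<phi> x \<notin> {s, s'}"
    have "\<phi> x = x"
      using sep[OF order_isomorphism_mem[OF that(1) x] x ne] card_down_up[OF that(1) x] by simp
    then show False using ne that(2) by simp
  qed
  have "inj_on (\<lambda>\<phi>. \<phi> s) (carrier (order_AutoGroup L))"
  proof (rule inj_onI)
    fix \<phi> \<psi> assume A: "\<phi> \<in> carrier (order_AutoGroup L)" "\<psi> \<in> carrier (order_AutoGroup L)" and eq: "\<phi> s = \<psi> s"
    have iso: "order_isomorphism L L \<phi>" "order_isomorphism L L \<psi>"
      using A by (simp_all add: carrier_order_AutoGroup)
    have inj: "inj_on \<phi> (carrier L)" "inj_on \<psi> (carrier L)"
      using order_isomorphism_bij[OF iso(1)] order_isomorphism_bij[OF iso(2)] by (simp_all add: bij_betw_def)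
    have s': "\<phi> s' = \<psi> s'"
    proof (cases "s = s'")
      case False
      then have "\<phi> s' \<noteq> \<phi> s" "\<psi> s' \<noteq> \<psi> s"
        using inj s by (auto simp: inj_on_def)
      then show ?thesis
        using moved[OF iso(1), of s] moved[OF iso(1), of s'] moved[OF iso(2), of s'] eq by auto
    qed (use eq in simp)
    show "\<phi> = \<psi>"
    proof (rule extensionalityI[of _ "carrier L"])
      fix x assume "x \<in> carrier L"
      then show "\<phi> x = \<psi> x" using fixed iso eq s' by (metis insertE singletonD)
    qed (use A in \<open>auto simp: carrier_order_AutoGroup\<close>)
  qed
  moreover have "(\<lambda>\<phi>. \<phi> s) ` carrier (order_AutoGroup L) \<subseteq> {s, s'}"
    using moved[OF _ insertI1] by (intro image_subsetI) (simp only: carrier_order_AutoGroup)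
  moreover have "card {s, s'} \<le> 2" by (simp add: card_insert_if)
  ultimately show ?thesis
    using inj_on_finite[of "\<lambda>\<phi>. \<phi> s" _ "{s, s'}"] card_inj_on_le[of "\<lambda>\<phi>. \<phi> s" _ "{s, s'}"] by fastforce
qed

text \<open>Explicit finite bounds on all three components allow the set to be enumerated by
  evaluation.\<close>

definition bool_triples ::
    "bool set \<Rightarrow> bool set \<Rightarrow> bool set \<Rightarrow> (bool set \<times> bool set \<times> bool set set) set" where
  "bool_triples C B J = {(Y, F, W) \<in> Pow C \<times> Pow C \<times> Pow (Pow (C \<union> B)).
     F \<subseteq> Y \<and> Y - F \<subseteq> J \<and> {} \<in> W \<and> W \<subseteq> Pow (F \<union> B) \<and> (\<forall>v\<in>W. \<forall>w\<in>W. sym_diff v w \<in> W)}"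

lemma carrier_triple_lattice_bool: "carrier (triple_lattice C B J) = bool_triples C B J"
proof (rule Set.set_eqI)
  fix x :: "bool set \<times> bool set \<times> bool set set"
  obtain Y F W where x: "x = (Y, F, W)" by (rule prod_cases3)
  have "W \<subseteq> Pow (C \<union> B)" "F \<subseteq> C" if "W \<subseteq> Pow (F \<union> B)" "F \<subseteq> Y" "Y \<subseteq> C"
  proof -
    show "F \<subseteq> C" using that(2,3) by (rule order_trans)
    then have "F \<union> B \<subseteq> C \<union> B" by (intro Un_mono order_refl)
    then show "W \<subseteq> Pow (C \<union> B)" using that(1) Pow_mono order_trans by metis
  qed
  then show "x \<in> carrier (triple_lattice C B J) \<longleftrightarrow> x \<in> bool_triples C B J"
    unfolding x mem_triple_lattice bool_triples_def binary_subspaces_def mem_Collect_eq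
      prod.case mem_Times_iff fst_conv snd_conv Pow_iff by argo
qed

fun triple_le :: "'i set \<times> 'i set \<times> 'i set set \<Rightarrow> 'i set \<times> 'i set \<times> 'i set set \<Rightarrow> bool" where
  "triple_le (Y, F, W) (Y', F', W') \<longleftrightarrow> Y \<subseteq> Y' \<and> F \<subseteq> F' \<and> W \<subseteq> W'"

lemma le_triple_lattice_eq: "x \<sqsubseteq>\<^bsub>triple_lattice C B J\<^esub> y \<longleftrightarrow> triple_le x y"
  by (cases x; cases y) (simp add: le_triple_lattice)

text \<open>An automorphism preserves the sizes of principal ideals and filters, so outside \<open>E\<close> it fixes
  every element.\<close>

definition separated_outside where
  "separated_outside A E \<longleftrightarrow> E \<subseteq> A \<and> (\<forall>x\<in>A. x \<in> E \<or> (\<forall>y\<in>A.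
     card {z \<in> A. triple_le z x} = card {z \<in> A. triple_le z y} \<and>
     card {z \<in> A. triple_le x z} = card {z \<in> A. triple_le y z} \<longrightarrow> x = y))"

lemma card_le_2_of_separated:
  assumes "separated_outside (bool_triples C B J) {s, s'}"
  shows "finite (carrier (order_AutoGroup (triple_lattice C B J))) \<and>
    card (carrier (order_AutoGroup (triple_lattice C B J))) \<le> 2"
proof (rule card_order_AutoGroup_le_2)
  show "s \<in> carrier (triple_lattice C B J)" "s' \<in> carrier (triple_lattice C B J)"
    using assms by (simp_all add: separated_outside_def carrier_triple_lattice_bool)
  fix x y assume "x \<in> carrier (triple_lattice C B J)" "y \<in> carrier (triple_lattice C B J)" "x \<notin> {s, s'}"
    "card (down (triple_lattice C B J) x) = card (down (triple_lattice C B J) y)"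
    "card (up (triple_lattice C B J) x) = card (up (triple_lattice C B J) y)"
  then show "x = y"
    using assms unfolding separated_outside_def down_def up_def carrier_triple_lattice_bool
      le_triple_lattice_eq by blast
qed

text \<open>Over the full alternating part there are three lines of sign vectors. The one spanned by
  the degree 2 coordinate also occurs without the alternating part, so its ideal is larger. The
  other two, spanned by the vector odd only in the large factor and by the vector odd in both, form
  the exceptional pair. If \<open>C\<close> is empty, both entries of the pair are the least
  element.\<close>

lemma card_order_AutoGroup_one_degree_2:
  assumes "C \<subseteq> {\<not> b}" "J \<subseteq> C"
  shows "finite (carrier (order_AutoGroup (triple_lattice C {b} J))) \<and>
    card (carrier (order_AutoGroup (triple_lattice C {b} J))) \<le> 2"
proof -
  have C: "C = {} \<or> C = {\<not> b}" and J: "J = {} \<or> J = C" using assms by blast+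
  have "separated_outside (bool_triples {} {False} {}) {({}, {}, {{}}), ({}, {}, {{}})}"
    "separated_outside (bool_triples {} {True} {}) {({}, {}, {{}}), ({}, {}, {{}})}"
    "separated_outside (bool_triples {True} {False} {})
       {({True}, {True}, {{}, {True}}), ({True}, {True}, {{}, {True, False}})}"
    "separated_outside (bool_triples {True} {False} {True})
       {({True}, {True}, {{}, {True}}), ({True}, {True}, {{}, {True, False}})}"
    "separated_outside (bool_triples {False} {True} {})
       {({False}, {False}, {{}, {False}}), ({False}, {False}, {{}, {True, False}})}"
    "separated_outside (bool_triples {False} {True} {False})
       {({False}, {False}, {{}, {False}}), ({False}, {False}, {{}, {True, False}})}"
    by code_simp+
  note this[THEN card_le_2_of_separated]
  then show ?thesis using C J by (cases b) auto
qed

text \<open>Each automorphism comes from a permutation of \<open>C\<close>, hence from one of the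
  two permutations of the truth values.\<close>

lemma card_order_AutoGroup_no_degree_2:
  assumes "J \<subseteq> C"
  shows "finite (carrier (order_AutoGroup (triple_lattice (C :: bool set) {} J))) \<and>
    card (carrier (order_AutoGroup (triple_lattice C {} J))) \<le> 2"
proof -
  let ?L = "triple_lattice C {} J" and ?S = "{\<sigma> :: bool \<Rightarrow> bool. \<sigma> permutes UNIV}"
  have "carrier (order_AutoGroup ?L) \<subseteq> (\<lambda>\<sigma>. restrict (act \<sigma>) (carrier ?L)) ` ?S"
  proof
    fix \<phi> assume \<phi>: "\<phi> \<in> carrier (order_AutoGroup ?L)"
    then obtain \<sigma> where \<sigma>: "\<sigma> permutes C" "\<And>x. x \<in> carrier ?L \<Longrightarrow> \<phi> x = act \<sigma> x"
      using triple_lattice_automorphism_eq_act[OF _ assms] unfolding carrier_order_AutoGroup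
      by (metis finite)
    then have "\<phi> = restrict (act \<sigma>) (carrier ?L)"
      using \<phi> by (intro extensionalityI[of _ "carrier ?L"]) (auto simp: carrier_order_AutoGroup)
    moreover have "\<sigma> \<in> ?S" using permutes_subset[OF \<sigma>(1) subset_UNIV] by simp
    ultimately show "\<phi> \<in> (\<lambda>\<sigma>. restrict (act \<sigma>) (carrier ?L)) ` ?S" by (rule image_eqI)
  qed
  moreover have "finite ?S" "card ?S = 2"
    using finite_permutations[of "UNIV :: bool set"] card_permutations[of "UNIV :: bool set" 2]
    by (simp_all add: UNIV_bool)
  ultimately show ?thesis
    using finite_surj surj_card_le by (metis (no_types))
qed

section \<open>The exceptional lattice of S_2 x S_2\<close>

text \<open>Naming the three middle elements 1, 2, 3 makes the automorphisms the members of
  \<open>sym_group 3\<close> themselves, restricted to the carrier; 0 and 4 are fixed.\<close>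

definition diamond :: "nat gorder" where
  "diamond = \<lparr>carrier = {0..4}, eq = (=), le = (\<lambda>i j. i = j \<or> i = 0 \<or> j = 4)\<rparr>"

lemma diamond_simps:
  "carrier diamond = {0..4}" "i \<sqsubseteq>\<^bsub>diamond\<^esub> j \<longleftrightarrow> i = j \<or> i = 0 \<or> j = 4"
  by (simp_all add: diamond_def)

text \<open>The list runs through the five subspaces of the plane over the field with two elements:
  zero, the three lines and the plane.\<close>

definition diamond_map :: "nat \<Rightarrow> bool set \<times> bool set \<times> bool set set" where
  "diamond_map i = ({}, {}, [{{}}, {{}, {True}}, {{}, {False}}, {{}, {True, False}},
     {{}, {True}, {False}, {True, False}}] ! i)"

lemma diamond_iso: "order_isomorphism diamond (triple_lattice {} UNIV {}) diamond_map"
proof (rule order_isomorphismI)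
  have "\<forall>i\<in>{0..4}. \<forall>j\<in>{0..4}. diamond_map i = diamond_map j \<longrightarrow> i = j"
    "diamond_map ` {0..4} = bool_triples {} {True, False} {}"
    by code_simp+
  moreover have "(UNIV :: bool set) = {True, False}" by auto
  ultimately show "bij_betw diamond_map (carrier diamond) (carrier (triple_lattice {} UNIV {}))"
    by (simp add: bij_betw_def inj_on_def diamond_simps carrier_triple_lattice_bool)
  have "\<forall>i\<in>{0..4}. \<forall>j\<in>{0..4}. (i = j \<or> i = 0 \<or> j = 4) \<longleftrightarrow> triple_le (diamond_map i) (diamond_map j)"
    by code_simp
  then show "i \<sqsubseteq>\<^bsub>diamond\<^esub> j \<longleftrightarrow> diamond_map i \<sqsubseteq>\<^bsub>triple_lattice {} UNIV {}\<^esub> diamond_map j"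
    if "i \<in> carrier diamond" "j \<in> carrier diamond" for i j
    using that by (simp add: diamond_simps le_triple_lattice_eq)
qed

lemma sym_group_3_iso_diamond: "sym_group 3 \<cong> order_AutoGroup diamond"
proof -
  define \<Theta> where "\<Theta> \<pi> = restrict \<pi> {0..4::nat}" for \<pi> :: "nat \<Rightarrow> nat"
  have five: "{0..4} = insert 0 (insert 4 {1..3::nat})" by auto
  have mem: "\<Theta> \<pi> \<in> carrier (order_AutoGroup diamond)" if \<pi>: "\<pi> \<in> carrier (sym_group 3)" for \<pi>
  proof -
    have p: "\<pi> permutes {1..3}" using \<pi> sym_group_carrier by blast
    then have p': "\<pi> permutes {0..4}" by (rule permutes_subset) auto
    have fixed: "\<pi> 0 = 0" "\<pi> 4 = 4" using p by (simp_all add: permutes_not_in)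
    have inj: "\<pi> i = \<pi> j \<longleftrightarrow> i = j" for i j using permutes_inj[OF p] by (auto dest: injD)
    have "order_isomorphism diamond diamond \<pi>"
    proof (rule order_isomorphismI)
      show "bij_betw \<pi> (carrier diamond) (carrier diamond)"
        unfolding diamond_simps by (rule permutes_imp_bij[OF p'])
      show "i \<sqsubseteq>\<^bsub>diamond\<^esub> j \<longleftrightarrow> \<pi> i \<sqsubseteq>\<^bsub>diamond\<^esub> \<pi> j" for i j
        unfolding diamond_simps using inj[of i 0] inj[of j 4] inj[of i j] fixed by simp
    qed
    then show ?thesis
      unfolding carrier_order_AutoGroup \<Theta>_def
      using order_isomorphism_cong[of diamond diamond \<pi>] by (simp add: diamond_simps)
  qed
  have "\<Theta> \<in> iso (sym_group 3) (order_AutoGroup diamond)"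
  proof (rule isoI)
    show "\<Theta> \<in> hom (sym_group 3) (order_AutoGroup diamond)"
    proof (rule homI)
      fix \<pi> \<pi>' assume \<pi>: "\<pi> \<in> carrier (sym_group 3)" "\<pi>' \<in> carrier (sym_group 3)"
      have "\<pi>' permutes {1..3}" using \<pi>(2) sym_group_carrier by blast
      then have "\<pi>' permutes {0..4}" by (rule permutes_subset) auto
      then have "\<pi>' i \<in> {0..4}" if "i \<in> {0..4}" for i using that by (simp only: permutes_in_image)
      then show "\<Theta> (\<pi> \<otimes>\<^bsub>sym_group 3\<^esub> \<pi>') = \<Theta> \<pi> \<otimes>\<^bsub>order_AutoGroup diamond\<^esub> \<Theta> \<pi>'"
        unfolding mult_order_AutoGroup[OF mem[OF \<pi>(1)] mem[OF \<pi>(2)]] sym_group_mult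
        unfolding \<Theta>_def compose_def diamond_simps by (intro restrict_ext) simp
    qed (rule mem)
    show "bij_betw \<Theta> (carrier (sym_group 3)) (carrier (order_AutoGroup diamond))"
      unfolding bij_betw_def
    proof
      show "inj_on \<Theta> (carrier (sym_group 3))"
      proof (rule inj_onI)
        fix \<pi> \<pi>' assume \<pi>: "\<pi> \<in> carrier (sym_group 3)" "\<pi>' \<in> carrier (sym_group 3)" and eq: "\<Theta> \<pi> = \<Theta> \<pi>'"
        have p: "\<pi> permutes {1..3}" "\<pi>' permutes {1..3}" using \<pi> sym_group_carrier by blast+
        show "\<pi> = \<pi>'"
        proof
          fix i show "\<pi> i = \<pi>' i"
          proof (cases "i \<in> {1..3}")
            case True
            then have "i \<in> {0..4}" by simp
            then show ?thesis using fun_cong[OF eq, of i] by (simp add: \<Theta>_def)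
          next
            case False
            then show ?thesis by (metis p permutes_not_in)
          qed
        qed
      qed
      show "\<Theta> ` carrier (sym_group 3) = carrier (order_AutoGroup diamond)"
      proof
        show "\<Theta> ` carrier (sym_group 3) \<subseteq> carrier (order_AutoGroup diamond)"
          using mem by (rule image_subsetI)
        show "carrier (order_AutoGroup diamond) \<subseteq> \<Theta> ` carrier (sym_group 3)"
        proof
          fix \<phi> assume "\<phi> \<in> carrier (order_AutoGroup diamond)"
          then have ext: "\<phi> \<in> extensional {0..4}" and iso: "order_isomorphism diamond diamond \<phi>"
            by (simp_all add: carrier_order_AutoGroup diamond_simps)
          have bij: "bij_betw \<phi> {0..4} {0..4}"
            using order_isomorphism_bij[OF iso] by (simp only: diamond_simps)
          have le: "\<phi> i = \<phi> j \<or> \<phi> i = 0 \<or> \<phi> j = 4 \<longleftrightarrow> i = j \<or> i = 0 \<or> j = 4"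
            if "i \<in> {0..4}" "j \<in> {0..4}" for i j
            using order_isomorphism_le[OF iso, of i j] that by (simp only: diamond_simps)
          have inj: "\<phi> i = \<phi> j \<longleftrightarrow> i = j" if "i \<in> {0..4}" "j \<in> {0..4}" for i j
            using inj_on_eq_iff[OF bij_betw_imp_inj_on[OF bij] that] .
          \<comment> \<open>The image of 0 lies strictly below two distinct elements, which is true
            only of 0. The argument for 4 is dual.\<close>
          have 0: "\<phi> 0 = 0" using le[of 0 1] le[of 0 2] inj[of 0 1] inj[of 0 2] inj[of 1 2] by auto
          have 4: "\<phi> 4 = 4" using le[of 1 4] le[of 2 4] inj[of 1 4] inj[of 2 4] inj[of 1 2] by auto
          \<comment> \<open>Outside the carrier \<open>\<phi>\<close> has the value
            \<open>undefined\<close>, whereas a permutation has to be the identity there.\<close>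
          define \<pi> where "\<pi> i = (if i \<in> {0..4} then \<phi> i else i)" for i
          have "bij_betw \<pi> {0..4} {0..4}"
            using bij_betw_cong[of "{0..4}" \<pi> \<phi> "{0..4}"] bij by (simp add: \<pi>_def)
          then have p: "\<pi> permutes {0..4}" by (rule bij_imp_permutes) (simp only: \<pi>_def if_False)
          have "\<pi> permutes {1..3}"
          proof (rule permutes_superset[OF p])
            fix i assume "i \<in> {0..4} - {1..3::nat}"
            then have "i = 0 \<or> i = 4" by auto
            then show "\<pi> i = i" using 0 4 by (auto simp: \<pi>_def)
          qed
          then have "\<pi> \<in> carrier (sym_group 3)" using sym_group_carrier by blast
          moreover have "\<phi> = \<Theta> \<pi>"
            using ext by (intro extensionalityI[of _ "{0..4}"]) (auto simp: \<Theta>_def \<pi>_def)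
          ultimately show "\<phi> \<in> \<Theta> ` carrier (sym_group 3)" by (simp only: imageI)
        qed
      qed
    qed
  qed
  then show ?thesis by (rule is_isoI)
qed

lemma group_order_AutoGroup: "group (order_AutoGroup L)"
  using subgroup.subgroup_is_group[OF subgroup_order_AutoGroup group_BijGroup, of L]
  by (simp add: order_AutoGroup_def)

lemma trivial_LatAut_iso:
  assumes "G \<cong> H" "group G" "group H" "trivial_group (LatAut H)"
  shows "trivial_group (LatAut G)"
  using isomorphic_group_triviality1[OF group.iso_sym[OF group_LatAut LatAut_iso[OF assms(2,3,1)]] group_LatAut assms(4)] .

section \<open>The tower\<close>

text \<open>Without factors of degree at least 3 the components \<open>Y\<close> and
  \<open>F\<close> are empty, and a triple is just a subspace of the plane.\<close>

lemma LatAut_S2_S2_iso_sym_group_3: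
  "LatAut (product_group UNIV (\<lambda>b :: bool. sym_group 2)) \<cong> sym_group 3"
proof -
  interpret sym_product "UNIV :: bool set" "\<lambda>_. 2"
    by unfold_locales simp
  have *: "large = {}" "twos = UNIV" "fours = {}" by (auto simp: large_def twos_def fours_def)
  have "LatAut (product_group UNIV (\<lambda>b :: bool. sym_group 2)) \<cong> order_AutoGroup (triple_lattice {} (UNIV :: bool set) {})"
    using LatAut_P_iso unfolding * P_def .
  also have "\<dots> \<cong> order_AutoGroup diamond"
    by (rule group.iso_sym[OF group_order_AutoGroup order_AutoGroup_iso[OF diamond_iso]])
  also have "\<dots> \<cong> sym_group 3"
    by (rule group.iso_sym[OF sym_group_is_group sym_group_3_iso_diamond])
  finally show ?thesis .
qed

text \<open>The number of factors of degree 2 separates the cases: with none, automorphisms permute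
  the factors of degree at least 3; with one, the bound comes from evaluation; with two, the group
  is S_3.\<close>

lemma trivial_second_LatAut_two_factors:
  "trivial_group (LatAut (LatAut (product_group UNIV (\<lambda>b :: bool. sym_group (c b)))))"
proof -
  interpret sym_product "UNIV :: bool set" c
    by unfold_locales simp
  let ?A = "order_AutoGroup (triple_lattice large twos fours)"
  have iso: "LatAut (product_group UNIV (\<lambda>b. sym_group (c b))) \<cong> ?A"
    using LatAut_P_iso unfolding P_def .
  have sub: "fours \<subseteq> large" "large \<inter> twos = {}" by (auto simp: fours_def large_def twos_def)
  have small: "trivial_group (LatAut (LatAut (product_group UNIV (\<lambda>b. sym_group (c b)))))"
    if "finite (carrier ?A) \<and> card (carrier ?A) \<le> 2"
  proof -
    have "trivial_group (LatAut ?A)"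
      using that by (elim conjE) (rule trivial_LatAut_of_card_le_2[OF group_order_AutoGroup])
    then show ?thesis
      by (rule trivial_LatAut_iso[OF iso group_LatAut group_order_AutoGroup])
  qed
  have "twos \<in> Pow UNIV" by simp
  then consider "twos = {}" | b where "twos = {b}" | "twos = UNIV"
    unfolding UNIV_bool Pow_insert Pow_empty by blast
  then show ?thesis
  proof cases
    case 3
    then have "c = (\<lambda>b. 2)" by (auto simp: twos_def)
    then show ?thesis
      using trivial_LatAut_iso[OF LatAut_S2_S2_iso_sym_group_3 group_LatAut sym_group_is_group
          trivial_LatAut_sym_group_3] by simp
  next
    case 1
    then have "finite (carrier ?A) \<and> card (carrier ?A) \<le> 2"
      using card_order_AutoGroup_no_degree_2[OF sub(1)] by simp
    then show ?thesis by (rule small)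
  next
    case (2 b)
    have "large \<subseteq> {\<not> b}" using sub(2) 2 by (simp add: disjoint_iff subset_iff)
    then have "finite (carrier ?A) \<and> card (carrier ?A) \<le> 2"
      using card_order_AutoGroup_one_degree_2[OF _ sub(1)] 2 by simp
    then show ?thesis by (rule small)
  qed
qed

text \<open>Reindexing by pairs of a truth value and a number sorts the factors by whether the
  degree is 4. Among degrees of at least 3 the triple lattice sees no other distinction.\<close>

lemma LatAut_iso_two_factors:
  assumes I: "finite I" "\<And>i. i \<in> I \<Longrightarrow> k i \<ge> 3"
    and G: "group G" "G \<cong> product_group I (\<lambda>i. sym_group (k i))"
  defines "c \<equiv> \<lambda>b. card {i \<in> I. (k i = 4) = b}"
  shows "LatAut G \<cong> product_group UNIV (\<lambda>b. sym_group (c b))"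
proof -
  have "\<exists>h. bij_betw h {1..c b} {i \<in> I. (k i = 4) = b}" for b
    unfolding c_def using I(1) by (intro ex_bij_betw_nat_finite_1) simp
  then obtain h where h: "\<And>b. bij_betw (h b) {1..c b} {i \<in> I. (k i = 4) = b}" by metis
  define D where "D = (SIGMA b:UNIV. {1..c b})"
  define e where "e = (\<lambda>(b, i). h b i)"
  have h_mem: "h b i \<in> I" "(k (h b i) = 4) = b" if "i \<in> {1..c b}" for b i
    using bij_betwE[OF h[of b]] that by blast+
  have h_inj: "i = j" if "i \<in> {1..c b}" "j \<in> {1..c b}" "h b i = h b j" for b i j
    using h[of b] that by (meson bij_betw_def inj_onD)
  have e: "bij_betw e D I"
    unfolding bij_betw_def
  proof
    show "inj_on e D"
    proof (rule inj_onI)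
      fix x y assume xy: "x \<in> D" "y \<in> D" "e x = e y"
      obtain b i b' i' where [simp]: "x = (b, i)" "y = (b', i')" by (cases x; cases y) blast
      have i: "i \<in> {1..c b}" "i' \<in> {1..c b'}" "h b i = h b' i'"
        using xy by (simp_all add: D_def e_def)
      then have b: "b = b'" using h_mem(2) by metis
      then show "x = y" using h_inj[OF i(1)] i by simp
    qed
    show "e ` D = I"
    proof
      show "e ` D \<subseteq> I" unfolding D_def e_def
        using h_mem(1) by (intro image_subsetI, elim SigmaE) (simp only: prod.case)
      show "I \<subseteq> e ` D"
      proof
        fix i assume "i \<in> I"
        then have "i \<in> h (k i = 4) ` {1..c (k i = 4)}"
          using h[of "k i = 4"] by (simp add: bij_betw_def)
        then obtain j where "j \<in> {1..c (k i = 4)}" "i = h (k i = 4) j" by (rule imageE)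
        then have "(k i = 4, j) \<in> D" "i = e (k i = 4, j)" by (simp_all add: D_def e_def)
        then show "i \<in> e ` D" by (metis imageI)
      qed
    qed
  qed
  interpret sym_product D "\<lambda>x. k (e x)"
    by unfold_locales (simp add: D_def)
  have eI: "e x \<in> I" if "x \<in> D" for x using e that by (rule bij_betwE[rule_format])
  have large: "large = D" and twos: "twos = {}"
    using I(2)[OF eI] by (force simp: large_def, force simp: twos_def)
  have fours: "fours = {True} \<times> {1..c True}"
  proof (rule Set.set_eqI)
    fix x :: "bool \<times> nat"
    obtain b i where x: "x = (b, i)" by (rule prod.exhaust)
    have "x \<in> fours \<longleftrightarrow> x \<in> D \<and> k (h b i) = 4" unfolding fours_def unfolding e_def x by simp
    also have "\<dots> \<longleftrightarrow> i \<in> {1..c b} \<and> b" using h_mem(2)[of i b] unfolding D_def x by blast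
    also have "\<dots> \<longleftrightarrow> x \<in> {True} \<times> {1..c True}" unfolding x by (cases b) simp_all
    finally show "x \<in> fours \<longleftrightarrow> x \<in> {True} \<times> {1..c True}" .
  qed
  have "G \<cong> P"
    using iso_trans[OF G(2) product_group_reindex[OF e]] by (simp only: P_def)
  then have "LatAut G \<cong> LatAut P"
    by (rule LatAut_iso[OF G(1) group_P])
  also have "\<dots> \<cong> order_AutoGroup (triple_lattice D {} ({True} \<times> {1..c True}))"
    using LatAut_P_iso unfolding large twos fours .
  also have "\<dots> \<cong> product_group UNIV (\<lambda>b. sym_group (c b))"
    unfolding D_def
    by (rule group.iso_sym[OF _ product_sym_group_iso_order_AutoGroup]) (simp add: sym_group_is_group)
  finally show ?thesis .
qed

lemma trivial_third_LatAut:
  assumes "finite I" "\<And>i. i \<in> I \<Longrightarrow> k i \<ge> 3"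
    and "group G" "G \<cong> product_group I (\<lambda>i. sym_group (k i))"
  shows "trivial_group (LatAut (LatAut (LatAut G)))"
proof (rule trivial_LatAut_iso[OF _ group_LatAut group_LatAut trivial_second_LatAut_two_factors])
  show "LatAut (LatAut G) \<cong>
      LatAut (product_group UNIV (\<lambda>b. sym_group (card {i \<in> I. (k i = 4) = b})))"
    using LatAut_iso[OF group_LatAut _ LatAut_iso_two_factors[OF assms]] by (simp add: sym_group_is_group)
qed

theorem theorem1p2:
  shows "(\<forall>G\<^sub>0 :: ('a, 'b) monoid_scheme. tower_group G\<^sub>0 \<longrightarrow>
            trivial_group (LatAut (LatAut (LatAut G\<^sub>0)))) \<and>
         (let G\<^sub>0 = group_power (sym_group 4) 2 \<times>\<times> group_power (sym_group 3) 2 in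
            trivial_group (LatAut (LatAut (LatAut G\<^sub>0))) \<and>
            \<not> trivial_group (LatAut (LatAut G\<^sub>0)))"
proof
  show "\<forall>G\<^sub>0 :: ('a, 'b) monoid_scheme. tower_group G\<^sub>0 \<longrightarrow> trivial_group (LatAut (LatAut (LatAut G\<^sub>0)))"
  proof (intro allI impI)
    fix G\<^sub>0 :: "('a, 'b) monoid_scheme" assume "tower_group G\<^sub>0"
    then obtain a :: "nat \<Rightarrow> nat" where G: "group G\<^sub>0" and fin: "finite {k. k \<ge> 3 \<and> a k \<noteq> 0}"
      and iso: "G\<^sub>0 \<cong> product_group {3..} (\<lambda>k. group_power (sym_group k) (a k))"
      by (auto simp: tower_group_def)
    let ?I = "SIGMA k:{3..}. {..<a k}"
    \<comment> \<open>Degrees with \<open>a k = 0\<close> contribute no pairs, so the infinite range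
      of degrees leaves a finite index set.\<close>
    have "?I = (SIGMA k:{k. k \<ge> 3 \<and> a k \<noteq> 0}. {..<a k})" by auto
    then have finI: "finite ?I" using fin by simp
    have "G\<^sub>0 \<cong> product_group ?I (\<lambda>(k, i). sym_group k)"
      using iso_trans[OF iso] product_group_Sigma[of "{3..}" "\<lambda>k. {..<a k}" "\<lambda>k i. sym_group k"]
      by (simp add: group_power_def)
    moreover have "(\<lambda>(k, i). sym_group k) = (\<lambda>x :: nat \<times> nat. sym_group (fst x))"
      by (simp add: fun_eq_iff)
    ultimately have "G\<^sub>0 \<cong> product_group ?I (\<lambda>x. sym_group (fst x))" by (simp only:)
    then show "trivial_group (LatAut (LatAut (LatAut G\<^sub>0)))"
      by (intro trivial_third_LatAut[OF finI _ G]) auto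
  qed
next
  let ?G = "group_power (sym_group 4) 2 \<times>\<times> group_power (sym_group 3) 2"
  let ?k = "\<lambda>x :: bool \<times> nat. if fst x then 4 else 3 :: nat" and ?I = "UNIV \<times> {..<2} :: (bool \<times> nat) set"
  have G: "group ?G"
    by (simp add: group_power_def DirProd_group sym_group_is_group)
  have "?G \<cong> product_group UNIV (\<lambda>b. if b then group_power (sym_group 4) 2 else group_power (sym_group 3) 2)"
    by (rule DirProd_iso_product_group)
  also have "(\<lambda>b. if b then group_power (sym_group 4) 2 else group_power (sym_group 3) 2) =
      (\<lambda>b. product_group {..<2 :: nat} (\<lambda>_. sym_group (if b then 4 else 3)))"
    by (simp add: group_power_def fun_eq_iff)
  also have "product_group UNIV \<dots> \<cong> product_group ?I (\<lambda>(b, i). sym_group (if b then 4 else 3))"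
    by (rule product_group_Sigma)
  also have "(\<lambda>(b, i). sym_group (if b then 4 else 3)) = (\<lambda>x :: bool \<times> nat. sym_group (?k x))"
    by (simp add: fun_eq_iff)
  finally have iso: "?G \<cong> product_group ?I (\<lambda>x. sym_group (?k x))" .
  \<comment> \<open>Each class contains two factors, which makes the first automorphism group the
    exceptional S_2 x S_2.\<close>
  have "{x \<in> ?I. (?k x = 4) = b} = {b} \<times> {..<2}" for b by (auto split: if_splits)
  then have "card {x \<in> ?I. (?k x = 4) = b} = 2" for b by simp
  then have "LatAut ?G \<cong> product_group UNIV (\<lambda>b :: bool. sym_group 2)"
    using LatAut_iso_two_factors[OF _ _ G iso] by simp
  then have "LatAut (LatAut ?G) \<cong> LatAut (product_group UNIV (\<lambda>b :: bool. sym_group 2))"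
    by (rule LatAut_iso[OF group_LatAut, rotated]) (simp add: sym_group_is_group)
  also have "\<dots> \<cong> sym_group 3" by (rule LatAut_S2_S2_iso_sym_group_3)
  finally have "trivial_group (LatAut (LatAut ?G)) \<longleftrightarrow> trivial_group (sym_group 3)"
    by (rule isomorphic_group_triviality[OF _ group_LatAut sym_group_is_group])
  \<comment> \<open>S_3 has six elements.\<close>
  moreover have "\<not> trivial_group (sym_group 3)"
    using sym_group_card_carrier[of 3] by (auto simp: trivial_group_def fact_numeral)
  moreover have "trivial_group (LatAut (LatAut (LatAut ?G)))"
    by (rule trivial_third_LatAut[OF _ _ G iso]) auto
  ultimately show "let G\<^sub>0 = ?G in trivial_group (LatAut (LatAut (LatAut G\<^sub>0))) \<and>
      \<not> trivial_group (LatAut (LatAut G\<^sub>0))"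
    by (simp add: Let_def)
qed

end
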